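(* Let $A$ and $B$ be $n\times n$ positive definite matrices, let $0\le t\le 1$ and let $p>0$. Then for every unitarily invariant norm $|||\cdot|||$ on the space of $n\times n$ matrices, $$|||A\#_{t}B|||\leq |||e^{(1-t)\log A+t \log B}|||\leq \left|\left|\left|\left(B^{\frac{tp}{2}} A^{(1-t)p} B^{\frac{tp}{2}}\right)^{1/p}\right|\right|\right|\leq \left|\left|\left|\left((1-t)A^p+tB^p\right)^{1/p}\right|\right|\right|.$$
   Context: Matrices are $n\times n$ (complex), and positive definite matrices are Hermitian. Real powers and logarithms of positive definite matrices are defined by the usual functional calculus. For $0\le t\le 1$ the $t$-geometric mean of positive definite $A,B$ is $A\#_tB=A^{1/2}\left(A^{-1/2}BA^{-1/2}\right)^tA^{1/2}$. A norm $|||\cdot|||$ on $n\times n$ matrices is unitarily invariant if $|||UXV|||=|||X|||$ for all matrices $X$ and all unitary $U,V$. *)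

theory Defs
  imports "HOL-Analysis.Analysis"
begin

definition adj :: "complex ^ 'n ^ 'm \<Rightarrow> complex ^ 'm ^ 'n"
  where "adj A = map_matrix cnj (transpose A)"

definition hermitian :: "complex ^ 'n ^ 'n \<Rightarrow> bool"
  where "hermitian A \<longleftrightarrow> adj A = A"

definition unitary :: "complex ^ 'n ^ 'n \<Rightarrow> bool"
  where "unitary U \<longleftrightarrow> adj U ** U = mat 1 \<and> U ** adj U = mat 1"

definition pos_def :: "complex ^ 'n ^ 'n \<Rightarrow> bool"
  where "pos_def A \<longleftrightarrow>
    hermitian A \<and> (\<forall>x. x \<noteq> 0 \<longrightarrow> 0 < Re (\<Sum>i\<in>UNIV. cnj (x $ i) * (A *v x) $ i))"

definition diag :: "('n \<Rightarrow> real) \<Rightarrow> complex ^ 'n ^ 'n"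
  where "diag d = (\<chi> i j. if i = j then complex_of_real (d i) else 0)"

text \<open>
  Functional calculus of a Hermitian matrix: \<open>f(U D U\<^sup>*) = U f(D) U\<^sup>*\<close> for unitary \<open>U\<close> and real
  diagonal \<open>D\<close>. The lemma \<open>mfun_unitary_diag\<close> below shows that the value does not depend on the
  chosen diagonalization. On non-Hermitian arguments \<open>mfun f\<close> is unspecified.
\<close>

definition mfun :: "(real \<Rightarrow> real) \<Rightarrow> complex ^ 'n ^ 'n \<Rightarrow> complex ^ 'n ^ 'n"
  where "mfun f A =
    (THE M. \<exists>U d. unitary U \<and> A = U ** diag d ** adj U \<and> M = U ** diag (\<lambda>i. f (d i)) ** adj U)"

lemma diag_mult_nth: "(diag d ** W) $ i $ j = complex_of_real (d i) * W $ i $ j"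
  and mult_diag_nth: "(W ** diag d) $ i $ j = W $ i $ j * complex_of_real (d j)"
  by (simp_all add: diag_def matrix_matrix_mult_def if_distrib if_distribR cong: if_cong)

lemma mfun_unitary_diag:
  assumes "unitary U"
  shows "mfun f (U ** diag d ** adj U) = U ** diag (\<lambda>i. f (d i)) ** adj U"
  unfolding mfun_def
proof (rule the_equality)
  show "\<exists>V e. unitary V \<and> U ** diag d ** adj U = V ** diag e ** adj V \<and>
      U ** diag (\<lambda>i. f (d i)) ** adj U = V ** diag (\<lambda>i. f (e i)) ** adj V"
    using assms by blast
next
  fix M
  assume "\<exists>V e. unitary V \<and> U ** diag d ** adj U = V ** diag e ** adj V \<and>
      M = V ** diag (\<lambda>i. f (e i)) ** adj V"
  then obtain V e where V: "unitary V" and eq: "U ** diag d ** adj U = V ** diag e ** adj V"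
    and M: "M = V ** diag (\<lambda>i. f (e i)) ** adj V" by blast
  define W where "W = adj V ** U"
  note un = assms[unfolded unitary_def] V[unfolded unitary_def]
  have "W ** diag d = adj V ** (U ** diag d ** adj U) ** U"
    using un by (simp add: W_def matrix_mul_assoc[symmetric])
  also have "\<dots> = (adj V ** V) ** diag e ** (adj V ** U)"
    unfolding eq by (simp only: matrix_mul_assoc)
  finally have "W ** diag d = diag e ** W"
    using un by (simp add: W_def)
  then have "W $ i $ j * complex_of_real (d j) = complex_of_real (e i) * W $ i $ j" for i j
    by (metis diag_mult_nth mult_diag_nth)
  then have "W $ i $ j = 0 \<or> d j = e i" for i j
    by (metis mult.commute mult_cancel_right of_real_eq_iff)
  then have "W ** diag (\<lambda>i. f (d i)) = diag (\<lambda>i. f (e i)) ** W"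
    by (auto simp: vec_eq_iff diag_mult_nth mult_diag_nth) (metis mult.commute)
  then have "V ** (W ** diag (\<lambda>i. f (d i))) ** adj U = V ** (diag (\<lambda>i. f (e i)) ** W) ** adj U"
    by simp
  then have "(V ** adj V) ** U ** diag (\<lambda>i. f (d i)) ** adj U
      = V ** diag (\<lambda>i. f (e i)) ** adj V ** (U ** adj U)"
    by (simp only: W_def matrix_mul_assoc)
  then show "M = U ** diag (\<lambda>i. f (d i)) ** adj U"
    using un M by simp
qed

definition mpow :: "complex ^ 'n ^ 'n \<Rightarrow> real \<Rightarrow> complex ^ 'n ^ 'n"
  where "mpow A r = mfun (\<lambda>x. x powr r) A"

definition mlog :: "complex ^ 'n ^ 'n \<Rightarrow> complex ^ 'n ^ 'n"
  where "mlog A = mfun ln A"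

text \<open>
  The multiplication and unit of the type class structure on \<open>vec\<close> are componentwise, so the library
  functions \<open>(^)\<close> and \<open>exp\<close> are not the matrix power and the matrix exponential.
\<close>

definition mexp :: "complex ^ 'n ^ 'n \<Rightarrow> complex ^ 'n ^ 'n"
  where "mexp X = (\<Sum>k. (((**) X ^^ k) (mat 1)) /\<^sub>R fact k)"

definition geo_mean :: "real \<Rightarrow> complex ^ 'n ^ 'n \<Rightarrow> complex ^ 'n ^ 'n \<Rightarrow> complex ^ 'n ^ 'n"
  where "geo_mean t A B =
    mpow A (1/2) ** mpow (mpow A (- 1/2) ** B ** mpow A (- 1/2)) t ** mpow A (1/2)"

definition is_matrix_norm :: "(complex ^ 'n ^ 'n \<Rightarrow> real) \<Rightarrow> bool"
  where "is_matrix_norm N \<longleftrightarrow>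
    (\<forall>X. 0 \<le> N X) \<and> (\<forall>X. N X = 0 \<longleftrightarrow> X = 0) \<and>
    (\<forall>c X. N (map_matrix (\<lambda>z. c * z) X) = cmod c * N X) \<and>
    (\<forall>X Y. N (X + Y) \<le> N X + N Y)"

definition unitarily_invariant_norm :: "(complex ^ 'n ^ 'n \<Rightarrow> real) \<Rightarrow> bool"
  where "unitarily_invariant_norm N \<longleftrightarrow>
    is_matrix_norm N \<and> (\<forall>U X V. unitary U \<longrightarrow> unitary V \<longrightarrow> N (U ** X ** V) = N X)"

end

(*
  The three inequalities are weak log-majorizations of eigenvalues, and Fan dominance turns them
  into norm inequalities. Products of k eigenvalues are handled without exterior powers: for P with
  eigenvalues d, the bound "every product of k of the d i is at most c" is equivalent to
  det_S (V* P V) <= c det_S (V* V) for all V and all k-element index sets S, where det_S is the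
  principal minor (Cauchy--Binet). The relation kle "det_S (V* P V) <= c det_S (V* Q V) for all V"
  is transitive and stable under congruence, so operator arguments for the largest eigenvalue carry
  over to all k at once.

  First inequality: Ando--Hiai, kle (A #_t B) I ==> kle (A^2 #_t B^2) I, applied to A^q, B^q with
  q = 2^-m, together with A^q #_t B^q <= (1-t) A^q + t B^q, whose derivative at q = 0 is
  (1-t) log A + t log B.
  Second inequality: Araki--Lieb--Thirring for the exponent 2 (spectral radius <= norm), iterated in
  the same way.
  Third inequality: if V consists of eigenvectors, Y^t V = X^(t-1) V D, then log-convexity of
  r |-> det_S (V* X^r V) and of r |-> det_S (V* Y^r V) gives
  det D <= det_S (V* X V)^(1-t) det_S (V* Y V)^t / det_S (V* V), and the determinant is
  log-concave.
*)
theory Submission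
  imports Defs
begin

subsection \<open>Adjoints and unitary matrices\<close>

text \<open>For each \<open>k\<close>, only bounds are transferred: every \<open>c\<close> bounding
  the \<open>k\<close>-fold eigenvalue products of the larger matrix must bound those of the smaller
  one. Keeping \<open>c\<close> as a parameter instead of normalising it to 1 lets it be raised to
  powers along with the matrices. Although \<open>kle\<close> tests decomposable vectors only, its
  comparison with \<open>mat 1\<close> determines these bounds exactly. Squaring and square roots
  suffice because the tangent comparison at a small exponent \<open>q\<close> costs a factor
  \<open>exp (e * q * k)\<close>, and amplification by \<open>1 / q\<close> turns it into
  \<open>exp (e * k)\<close>, uniformly in \<open>q\<close>; no Lie--Trotter product limit has to be
  established. The third inequality resists this method because exterior powers respect products,
  not sums: the \<open>k\<close>-th exterior power of a weighted arithmetic mean is not the mean of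
  the exterior powers. Log-concavity of the determinant takes the place of linearity there.\<close>

lemma adj_nth [simp]: "adj A $ i $ j = cnj (A $ j $ i)"
  by (simp add: adj_def transpose_def)

lemma adj_adj [simp]: "adj (adj A) = A"
  by (simp add: vec_eq_iff)

lemma adj_mult: "adj (A ** B) = adj B ** adj A"
  by (simp add: vec_eq_iff matrix_matrix_mult_def mult.commute)

lemma adj_one [simp]: "adj (mat 1) = mat 1"
  by (simp add: vec_eq_iff mat_def)

lemma adj_diag [simp]: "adj (diag d) = diag d"
  by (simp add: vec_eq_iff diag_def)

lemma adj_add: "adj (A + B) = adj A + adj B"
  and adj_scaleR: "adj (r *\<^sub>R A) = r *\<^sub>R adj A"
  by (simp_all add: vec_eq_iff)

lemma diag_one [simp]: "diag (\<lambda>i. 1) = mat 1"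
  by (simp add: vec_eq_iff diag_def mat_def)

lemma diag_mult_diag: "diag d ** diag e = diag (\<lambda>i. d i * e i)"
  by (simp add: vec_eq_iff diag_mult_nth) (simp add: diag_def)

lemma unitary_adj: "unitary U \<Longrightarrow> unitary (adj U)"
  by (simp add: unitary_def)

lemma unitary_mult: "unitary U \<Longrightarrow> unitary V \<Longrightarrow> unitary (U ** V)"
  unfolding unitary_def adj_mult
  by (metis matrix_mul_assoc matrix_mul_rid)

lemma unitary_mult_adj [simp]: "unitary U \<Longrightarrow> U ** adj U = mat 1"
  and unitary_adj_mult [simp]: "unitary U \<Longrightarrow> adj U ** U = mat 1"
  by (simp_all add: unitary_def)

lemma unitary_cancel [simp]: "unitary U \<Longrightarrow> X ** U ** adj U = X"
  and unitary_cancel' [simp]: "unitary U \<Longrightarrow> X ** adj U ** U = X"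
  by (simp_all add: matrix_mul_assoc[symmetric])

lemma diag_conj_mult:
  assumes "unitary U"
  shows "(U ** diag d ** adj U) ** (U ** diag e ** adj U) = U ** diag (\<lambda>i. d i * e i) ** adj U"
  using assms by (simp add: matrix_mul_assoc) (simp add: matrix_mul_assoc[symmetric] diag_mult_diag)

lemma invertible_unitary: "unitary U \<Longrightarrow> invertible U"
  unfolding unitary_def invertible_def by blast

lemma invertible_adj: "invertible A \<Longrightarrow> invertible (adj A)"
  unfolding invertible_def by (metis adj_mult adj_one)

lemma hermitian_conj: "hermitian A \<Longrightarrow> hermitian (adj X ** A ** X)"
  by (simp add: hermitian_def adj_mult matrix_mul_assoc)

lemma hermitian_diag_conj: "hermitian (U ** diag d ** adj U)"
  by (simp add: hermitian_def adj_mult matrix_mul_assoc)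

subsection \<open>The spectral theorem\<close>

definition cinner :: "complex ^ 'n \<Rightarrow> complex ^ 'n \<Rightarrow> complex"
  where "cinner x y = (\<Sum>i\<in>UNIV. cnj (x $ i) * y $ i)"

lemma Re_cinner: "Re (cinner x y) = inner x y"
  by (simp add: cinner_def inner_vec_def inner_complex_def)

lemma Im_cinner: "Im (cinner x y) = inner (\<i> *s x) y"
  by (simp add: cinner_def inner_vec_def inner_complex_def sum_subtractf mult.commute)

lemma cinner_commute: "cinner y x = cnj (cinner x y)"
  by (simp add: cinner_def mult.commute)

lemma cinner_add_right: "cinner z (x + y) = cinner z x + cinner z y"
  and cinner_smult_left: "cinner (c *s x) z = cnj c * cinner x z"
  and cinner_scaleR_right: "cinner z (r *\<^sub>R x) = of_real r * cinner z x"
  by (simp_all add: cinner_def algebra_simps sum.distrib sum_distrib_left sum_subtractf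
      scaleR_conv_of_real[where 'a = complex])

lemma cinner_self: "cinner x x = of_real ((norm x)\<^sup>2)"
proof (rule complex_eqI)
  show "Re (cinner x x) = Re (of_real ((norm x)\<^sup>2))"
    by (simp add: Re_cinner power2_norm_eq_inner)
  show "Im (cinner x x) = Im (of_real ((norm x)\<^sup>2))"
    by (simp add: cinner_def mult.commute)
qed

lemma cinner_mult_right: "cinner x (A *v y) = cinner (adj A *v x) y"
proof -
  have "cinner x (A *v y) = (\<Sum>i\<in>UNIV. \<Sum>j\<in>UNIV. cnj (x$i) * (A$i$j * y$j))"
    by (simp add: cinner_def matrix_vector_mult_def sum_distrib_left)
  also have "\<dots> = (\<Sum>j\<in>UNIV. \<Sum>i\<in>UNIV. cnj (x$i) * (A$i$j * y$j))"
    by (rule sum.swap)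
  also have "\<dots> = cinner (adj A *v x) y"
    by (simp add: cinner_def matrix_vector_mult_def sum_distrib_right sum_distrib_left algebra_simps)
  finally show ?thesis .
qed

lemma matrix_vector_scaleR: "A *v (r *\<^sub>R x) = r *\<^sub>R (A *v x)" for A :: "complex ^ 'n ^ 'm"
  by (rule linear_cmul[OF matrix_vector_mul_linear])

text \<open>A real dimension count: orthogonality to \<open>v i\<close> over the complex numbers is
  real orthogonality to both \<open>v i\<close> and \<open>\<i> *s v i\<close>, and
  \<open>2 * card S\<close> vectors cannot span a space of real dimension
  \<open>2 * CARD('n)\<close>.\<close>

lemma exists_unit_orthogonal:
  fixes v :: "'n \<Rightarrow> complex ^ 'n"
  assumes "S \<noteq> UNIV"
  shows "\<exists>x. norm x = 1 \<and> (\<forall>i\<in>S. cinner (v i) x = 0)"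
proof -
  define W where "W = v ` S \<union> (\<lambda>i. \<i> *s v i) ` S"
  have fin: "finite S" by simp
  have "card S < CARD('n)"
    using assms by (intro psubset_card_mono) auto
  moreover have "card W \<le> card S + card S"
    unfolding W_def by (rule order_trans[OF card_Un_le]) (intro add_mono card_image_le fin)
  moreover have "dim W \<le> card W"
    by (rule dim_le_card') (simp add: W_def)
  ultimately have "dim W < DIM(complex ^ 'n)" by simp
  then obtain x where x: "x \<noteq> 0" "\<And>y. y \<in> span W \<Longrightarrow> orthogonal x y"
    by (metis orthogonal_to_subspace_exists)
  have "cinner (v i) x = 0" if "i \<in> S" for i
  proof (rule complex_eqI)
    have "v i \<in> span W" "\<i> *s v i \<in> span W"
      using that by (auto simp: W_def intro: span_base)
    then show "Re (cinner (v i) x) = Re 0" "Im (cinner (v i) x) = Im 0"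
      using x(2) by (auto simp: Re_cinner Im_cinner orthogonal_def inner_commute[of _ x])
  qed
  then show ?thesis
    using x(1) by (intro exI[of _ "(1 / norm x) *\<^sub>R x"]) (simp add: cinner_scaleR_right)
qed

lemma continuous_on_mult_vec: "continuous_on S (\<lambda>x. A *v (x :: complex ^ 'n))"
  by (intro linear_continuous_on linear_conv_bounded_linear[THEN iffD1] matrix_vector_mul_linear)

text \<open>A maximizer of the quadratic form on the unit vectors of \<open>E\<close>, the
  orthogonal complement of the \<open>v i\<close>, is an eigenvector. As \<open>A\<close> maps
  \<open>E\<close> to itself, the residual \<open>A *v x - d *\<^sub>R x\<close> is an admissible
  direction of variation.\<close>

lemma hermitian_eigenvector_orthogonal:
  fixes A :: "complex ^ 'n ^ 'n" and v :: "'n \<Rightarrow> complex ^ 'n"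
  assumes A: "hermitian A" and "S \<noteq> UNIV"
    and eig: "\<And>i. i \<in> S \<Longrightarrow> A *v v i = of_real (e i) *s v i"
  shows "\<exists>x d. norm x = 1 \<and> (\<forall>i\<in>S. cinner (v i) x = 0) \<and> A *v x = complex_of_real d *s x"
proof -
  define E where "E = {x. \<forall>i\<in>S. cinner (v i) x = 0}"
  have E_sub: "a *\<^sub>R x + b *\<^sub>R y \<in> E" if "x \<in> E" "y \<in> E" for x y a b
    using that by (simp add: E_def cinner_add_right cinner_scaleR_right)
  have A_E: "A *v x \<in> E" if "x \<in> E" for x
    using that A eig by (simp add: E_def cinner_mult_right hermitian_def cinner_smult_left)
  have ce: "continuous_on T (\<lambda>x. cinner (v i) x)" for T i
    unfolding cinner_def by (intro continuous_intros)
  have "closed E"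
    unfolding E_def Ball_def by (intro closed_Collect_all closed_Collect_imp closed_Collect_eq ce open_Collect_const continuous_intros)
  then have "compact (sphere 0 1 \<inter> E)"
    by (intro compact_Int_closed) auto
  moreover have "sphere 0 1 \<inter> E \<noteq> {}"
    using exists_unit_orthogonal[OF \<open>S \<noteq> UNIV\<close>, of v] by (auto simp: E_def)
  moreover have "continuous_on (sphere 0 1 \<inter> E) (\<lambda>y. inner y (A *v y))"
    by (intro continuous_on_inner continuous_on_id continuous_on_mult_vec)
  ultimately obtain x where x: "x \<in> sphere 0 1 \<inter> E"
      and max: "\<And>y. y \<in> sphere 0 1 \<inter> E \<Longrightarrow> inner y (A *v y) \<le> inner x (A *v x)"
    using continuous_attains_sup[of "sphere 0 1 \<inter> E" "\<lambda>y. inner y (A *v y)"] by blast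
  define d where "d = inner x (A *v x)"
  have nx: "norm x = 1" and xE: "x \<in> E" using x by auto
  have gen: "inner w (A *v w) \<le> d * (norm w)\<^sup>2" if "w \<in> E" for w
  proof (cases "w = 0")
    case False
    have "(1 / norm w) *\<^sub>R w \<in> sphere 0 1 \<inter> E"
      using False E_sub[OF that that, of "1 / norm w" 0] by simp
    from max[OF this] show ?thesis
      using False by (simp add: d_def matrix_vector_scaleR divide_simps power2_eq_square mult.commute)
  qed simp
  define z where "z = A *v x - d *\<^sub>R x"
  have zE: "z \<in> E"
    using E_sub[OF A_E[OF xE] xE, of 1 "- d"] by (simp add: z_def)
  have sym: "inner z (A *v x) = inner x (A *v z)"
    using A by (metis Re_cinner cinner_mult_right hermitian_def inner_commute)
  \<comment> \<open>Moving from \<open>x\<close> by \<open>s\<close> in the direction of the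
    residual \<open>z\<close> gains \<open>2 * s * (norm z)\<^sup>2\<close> to first order;
    maximality allows at most a multiple of \<open>s\<^sup>2\<close>, which forces
    \<open>z = 0\<close>.\<close>
  have "2 * s * (norm z)\<^sup>2 \<le> s\<^sup>2 * (d * (norm z)\<^sup>2 - inner z (A *v z))" for s :: real
  proof -
    have "x + s *\<^sub>R z \<in> E" using E_sub[OF xE zE, of 1 s] by simp
    from gen[OF this]
    moreover have "(norm (x + s *\<^sub>R z))\<^sup>2 = 1 + 2 * s * inner z x + s\<^sup>2 * (norm z)\<^sup>2"
      using nx unfolding power2_norm_eq_inner
      by (simp add: inner_add_left inner_add_right norm_eq_1 algebra_simps power2_eq_square inner_commute[of x z])
    ultimately have "inner x (A *v x) + 2 * s * inner z (A *v x) + s\<^sup>2 * inner z (A *v z)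
        \<le> d * (1 + 2 * s * inner z x + s\<^sup>2 * (norm z)\<^sup>2)"
      using sym by (simp add: matrix_vector_right_distrib matrix_vector_scaleR inner_add_left
          inner_add_right algebra_simps power2_eq_square)
    moreover have "inner z (A *v x) = (norm z)\<^sup>2 + d * inner z x"
      by (simp add: power2_norm_eq_inner z_def inner_diff_left inner_diff_right algebra_simps)
    ultimately show ?thesis by (simp add: d_def[symmetric] algebra_simps)
  qed
  note quad = this
  have "(norm z)\<^sup>2 = 0"
  proof (rule ccontr)
    assume "(norm z)\<^sup>2 \<noteq> 0"
    then have pos: "(norm z)\<^sup>2 > 0" by simp
    \<comment> \<open>A positive bound for the coefficient of \<open>s\<^sup>2\<close>; the choice
      \<open>s = (norm z)\<^sup>2 / c\<close> then makes the left side twice the right side.\<close>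
    define c where "c = \<bar>d * (norm z)\<^sup>2 - inner z (A *v z)\<bar> + 1"
    have c: "c > 0" "d * (norm z)\<^sup>2 - inner z (A *v z) \<le> c" by (auto simp: c_def)
    have "2 * ((norm z)\<^sup>2 / c) * (norm z)\<^sup>2 \<le> ((norm z)\<^sup>2 / c)\<^sup>2 * c"
      by (rule order_trans[OF quad]) (intro mult_left_mono c, simp)
    then have "2 * ((norm z)\<^sup>2)\<^sup>2 / c \<le> ((norm z)\<^sup>2)\<^sup>2 / c"
      using c by (simp add: power2_eq_square)
    then show False using pos c by (simp add: divide_simps)
  qed
  then have "A *v x = of_real d *s x"
    by (simp add: z_def vec_eq_iff scaleR_conv_of_real[where 'a = complex])
  then show ?thesis
    using nx xE by (auto simp: E_def)
qed

lemma hermitian_orthonormal_eigenvectors: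
  fixes A :: "complex ^ 'n ^ 'n"
  assumes "hermitian A"
  shows "\<exists>(v :: 'n \<Rightarrow> complex ^ 'n) d. (\<forall>i\<in>S. \<forall>j\<in>S. cinner (v i) (v j) = (if i = j then 1 else 0))
    \<and> (\<forall>i\<in>S. A *v v i = complex_of_real (d i) *s v i)"
  using finite[of S]
proof (induction S rule: finite_induct)
  case (insert k S)
  then obtain v :: "'n \<Rightarrow> complex ^ 'n" and d where v: "\<And>i j. i \<in> S \<Longrightarrow> j \<in> S \<Longrightarrow> cinner (v i) (v j) = (if i = j then 1 else 0)"
    and eig: "\<And>i. i \<in> S \<Longrightarrow> A *v v i = complex_of_real (d i) *s v i"
    by blast
  from insert have "S \<noteq> UNIV" by blast
  then have "\<exists>x e. norm x = 1 \<and> (\<forall>i\<in>S. cinner (v i) x = 0) \<and> A *v x = complex_of_real e *s x"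
    by (rule hermitian_eigenvector_orthogonal[OF assms]) (rule eig)
  then obtain x e where x: "norm x = 1" "\<And>i. i \<in> S \<Longrightarrow> cinner (v i) x = 0"
    and e: "A *v x = complex_of_real e *s x"
    by blast
  have x': "cinner x (v i) = 0" if "i \<in> S" for i
    using x(2)[OF that] by (simp add: cinner_commute[of "v i"])
  show ?case
    using insert(2) v eig x x' e
    by (intro exI[of _ "v(k := x)"] exI[of _ "d(k := e)"]) (auto simp: cinner_self[of x])
qed auto

theorem hermitian_unitary_diag:
  fixes A :: "complex ^ 'n ^ 'n"
  assumes "hermitian A"
  obtains U d where "unitary U" and "A = U ** diag d ** adj U"
proof -
  obtain v :: "'n \<Rightarrow> complex ^ 'n" and d where v: "\<And>i j. cinner (v i) (v j) = (if i = j then 1 else 0)"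
    and eig: "\<And>i. A *v v i = complex_of_real (d i) *s v i"
    using hermitian_orthonormal_eigenvectors[OF assms, of UNIV] by blast
  define U where "U = (\<chi> i j. v j $ i)"
  have "adj U ** U = mat 1"
    using v by (simp add: vec_eq_iff matrix_matrix_mult_def U_def mat_def cinner_def)
  then have U: "unitary U"
    unfolding unitary_def using matrix_left_right_inverse by blast
  have "A ** U = U ** diag d"
    unfolding vec_eq_iff mult_diag_nth
    using eig by (simp add: vec_eq_iff matrix_matrix_mult_def matrix_vector_mult_def U_def mult.commute)
  then have "A ** U ** adj U = U ** diag d ** adj U" by simp
  with U have "A = U ** diag d ** adj U" by simp
  with U that show thesis by blast
qed

subsection \<open>Positive definite matrices and their powers\<close>

lemma pos_def_iff: "pos_def A \<longleftrightarrow> hermitian A \<and> (\<forall>x. x \<noteq> 0 \<longrightarrow> 0 < inner x (A *v x))"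
  by (simp add: pos_def_def Re_cinner[symmetric] cinner_def)

lemma pos_def_hermitian: "pos_def A \<Longrightarrow> hermitian A"
  by (simp add: pos_def_def)

lemma adj_pos_def: "pos_def A \<Longrightarrow> adj A = A"
  using pos_def_hermitian unfolding hermitian_def .

lemma inner_adj_left: "inner (adj X *v x) y = inner x (X *v y)"
  by (metis Re_cinner cinner_mult_right)

lemma inner_conj: "inner x ((adj X ** A ** X) *v x) = inner (X *v x) (A *v (X *v x))"
proof -
  have "inner x ((adj X ** A ** X) *v x) = inner (adj (adj X) *v x) (A *v (X *v x))"
    unfolding inner_adj_left by (simp only: matrix_vector_mul_assoc matrix_mul_assoc)
  then show ?thesis by simp
qed

lemma invertible_mult_vec_nonzero:
  fixes X :: "complex ^ 'n ^ 'n"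
  assumes "invertible X" "x \<noteq> 0"
  shows "X *v x \<noteq> 0"
  using assms unfolding invertible_def
  by (metis matrix_vector_mul_assoc matrix_vector_mul_lid matrix_vector_mult_0_right)

lemma pos_def_conj:
  fixes A X :: "complex ^ 'n ^ 'n"
  shows "pos_def A \<Longrightarrow> invertible X \<Longrightarrow> pos_def (adj X ** A ** X)"
  by (simp add: pos_def_iff hermitian_conj inner_conj invertible_mult_vec_nonzero)

lemma inner_diag: "inner x (diag d *v x) = (\<Sum>i\<in>UNIV. d i * (cmod (x $ i))\<^sup>2)"
proof -
  have "(diag d *v x) $ i = d i *\<^sub>R x $ i" for i
    by (simp add: matrix_vector_mult_def diag_def if_distrib[of "\<lambda>z. z * _"] scaleR_conv_of_real
        cong: if_cong)
  then show ?thesis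
    by (simp add: inner_vec_def power2_norm_eq_inner)
qed

lemma pos_def_diag: "(\<And>i. 0 < d i) \<Longrightarrow> pos_def (diag d)"
proof -
  assume d: "\<And>i. 0 < d i"
  have "0 < (\<Sum>i\<in>UNIV. d i * (cmod (x $ i))\<^sup>2)" if "x \<noteq> 0" for x
  proof -
    from that obtain j where "x $ j \<noteq> 0" by (auto simp: vec_eq_iff)
    with d show ?thesis
      by (intro sum_pos2[where i = j]) (auto intro!: mult_nonneg_nonneg less_imp_le[OF d])
  qed
  then show ?thesis by (simp add: pos_def_iff hermitian_def inner_diag)
qed

lemma pos_def_unitary_diag:
  assumes "unitary U" "\<And>i. 0 < d i"
  shows "pos_def (U ** diag d ** adj U)"
  using pos_def_conj[OF pos_def_diag[of d] invertible_adj[OF invertible_unitary[OF assms(1)]]] assms(2)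
  by simp

lemma pos_defE:
  assumes "pos_def A"
  obtains U d where "unitary U" "\<And>i. 0 < d i" "A = U ** diag d ** adj U"
proof -
  obtain U d where U: "unitary U" and A: "A = U ** diag d ** adj U"
    by (rule hermitian_unitary_diag[OF pos_def_hermitian[OF assms]])
  have "0 < d i" for i
  proof -
    have "pos_def (adj U ** A ** U)"
      by (rule pos_def_conj[OF assms invertible_unitary[OF U]])
    moreover have "adj U ** A ** U = diag d"
      using U by (simp add: A matrix_mul_assoc)
    ultimately have "0 < inner (axis i 1) (diag d *v axis i 1)"
      by (simp add: pos_def_iff axis_eq_0_iff)
    also have "\<dots> = (\<Sum>j\<in>UNIV. if j = i then d j else 0)"
      unfolding inner_diag by (rule sum.cong) (auto simp: axis_def)
    finally show ?thesis by simp
  qed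
  with U A that show thesis by blast
qed

lemma pos_def_one: "pos_def (mat 1)"
  using pos_def_diag[of "\<lambda>_. 1"] by simp

lemma pos_def_add: "pos_def A \<Longrightarrow> pos_def B \<Longrightarrow> pos_def (A + B)"
  by (simp add: pos_def_iff hermitian_def adj_add matrix_vector_mult_add_rdistrib inner_add_right add_pos_pos)

lemma scaleR_matrix_vector: "(r *\<^sub>R A) *v x = r *\<^sub>R (A *v x)" for A :: "complex ^ 'n ^ 'm"
  by (simp add: vec_eq_iff matrix_vector_mult_def scaleR_right.sum)

lemma pos_def_scaleR: "pos_def A \<Longrightarrow> 0 < r \<Longrightarrow> pos_def (r *\<^sub>R A)"
  by (simp add: pos_def_iff hermitian_def adj_scaleR scaleR_matrix_vector)

lemma pos_def_convex:
  assumes "pos_def A" "pos_def B" "0 \<le> t" "t \<le> 1"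
  shows "pos_def ((1 - t) *\<^sub>R A + t *\<^sub>R B)"
proof (cases "t = 0 \<or> t = 1")
  case False
  with assms show ?thesis by (intro pos_def_add pos_def_scaleR) auto
qed (use assms in auto)

lemma mpow_unitary_diag:
  "unitary U \<Longrightarrow> mpow (U ** diag d ** adj U) r = U ** diag (\<lambda>i. d i powr r) ** adj U"
  by (simp add: mpow_def mfun_unitary_diag)

lemma pos_def_mpow: "pos_def A \<Longrightarrow> pos_def (mpow A r)"
proof (elim pos_defE)
  fix U d assume U: "unitary U" "\<And>i. 0 < d i" "A = U ** diag d ** adj U"
  have "d i \<noteq> 0" for i using U(2)[of i] by simp
  with U(1,3) show "pos_def (mpow A r)"
    by (simp add: mpow_unitary_diag pos_def_unitary_diag)
qed

lemma adj_mpow: "pos_def A \<Longrightarrow> adj (mpow A r) = mpow A r"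
  by (intro adj_pos_def pos_def_mpow)

lemma mpow_add: "pos_def A \<Longrightarrow> mpow A r ** mpow A s = mpow A (r + s)"
  by (elim pos_defE) (simp add: mpow_unitary_diag diag_conj_mult powr_add)

lemma mpow_zero [simp]: "pos_def A \<Longrightarrow> mpow A 0 = mat 1"
proof (elim pos_defE)
  fix U d assume U: "unitary U" "\<And>i. 0 < d i" "A = U ** diag d ** adj U"
  have "d i \<noteq> 0" for i using U(2)[of i] by simp
  with U(1,3) show "mpow A 0 = mat 1"
    by (simp add: mpow_unitary_diag)
qed

lemma mpow_one [simp]: "pos_def A \<Longrightarrow> mpow A 1 = A"
  by (elim pos_defE) (simp add: mpow_unitary_diag less_imp_le)

lemma mpow_mpow: "pos_def A \<Longrightarrow> mpow (mpow A r) s = mpow A (r * s)"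
  by (elim pos_defE) (simp add: mpow_unitary_diag powr_powr)

lemma mpow_mult_inverse: "pos_def A \<Longrightarrow> r + s = 0 \<Longrightarrow> mpow A r ** mpow A s = mat 1"
  by (simp add: mpow_add)

lemma mpow_add_left: "pos_def A \<Longrightarrow> X ** mpow A r ** mpow A s = X ** mpow A (r + s)"
  by (simp add: matrix_mul_assoc[symmetric] mpow_add)

lemma invertible_mpow: "pos_def A \<Longrightarrow> invertible (mpow A r)"
  unfolding invertible_def using mpow_mult_inverse[of A r "- r"] mpow_mult_inverse[of A "- r" r]
  by auto

lemma pos_def_mpow_conj: "pos_def A \<Longrightarrow> pos_def B \<Longrightarrow> pos_def (mpow A r ** B ** mpow A r)"
  using pos_def_conj[of B "mpow A r"] by (simp add: adj_mpow invertible_mpow)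

text \<open>In eigenbases the hypothesis says that \<open>W $ i $ j\<close> vanishes unless
  \<open>d i = e j\<close>, and then \<open>f (d i) = f (e j)\<close>. This is what moves powers of
  \<open>Z ** adj Z\<close> past \<open>Z\<close>.\<close>

lemma mfun_intertwine:
  fixes A B X :: "complex ^ 'n ^ 'n"
  assumes A: "hermitian A" and B: "hermitian B" and AX: "A ** X = X ** B"
  shows "mfun f A ** X = X ** mfun f B"
proof -
  obtain U d where U: "unitary U" and A: "A = U ** diag d ** adj U"
    using hermitian_unitary_diag[OF A] .
  obtain V e where V: "unitary V" and B: "B = V ** diag e ** adj V"
    using hermitian_unitary_diag[OF B] .
  define W where "W = adj U ** X ** V"
  have "diag d ** W = adj U ** (A ** X) ** V"
    using U by (simp add: W_def A matrix_mul_assoc)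
  also have "\<dots> = W ** diag e"
    using V by (simp add: W_def AX) (simp add: B matrix_mul_assoc)
  finally have "(diag d ** W) $ i $ j = (W ** diag e) $ i $ j" for i j
    by (rule arg_cong)
  then have "of_real (d i) * W $ i $ j = W $ i $ j * of_real (e j)" for i j
    by (simp add: diag_mult_nth mult_diag_nth)
  then have "W $ i $ j = 0 \<or> d i = e j" for i j
    by (simp add: mult.commute[of _ "W $ i $ j"])
  then have "of_real (f (d i)) * W $ i $ j = W $ i $ j * of_real (f (e j))" for i j
    by (metis mult.commute mult_zero_right)
  then have eq: "diag (\<lambda>i. f (d i)) ** W = W ** diag (\<lambda>i. f (e i))"
    by (simp add: vec_eq_iff diag_mult_nth mult_diag_nth)
  have "X = U ** W ** adj V"
    using U V by (simp add: W_def matrix_mul_assoc)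
  then have "mfun f A ** X = U ** (diag (\<lambda>i. f (d i)) ** W) ** adj V"
    using U by (simp add: A mfun_unitary_diag matrix_mul_assoc)
  also have "\<dots> = X ** mfun f B"
    using V by (simp add: eq) (simp add: B mfun_unitary_diag \<open>X = _\<close> matrix_mul_assoc)
  finally show ?thesis .
qed

text \<open>The spectral decomposition into rank-one matrices that do not depend on
  \<open>e\<close>, so that series and derivatives in the eigenvalues reduce to scalar ones.\<close>

lemma diag_conj_sum:
  fixes U :: "complex ^ 'n ^ 'n"
  shows
  "U ** diag e ** adj U = (\<Sum>l\<in>UNIV. e l *\<^sub>R (\<chi> i j. U $ i $ l * cnj (U $ j $ l)))"
  by (simp add: vec_eq_iff matrix_matrix_mult_def[of _ "adj U"] mult_diag_nth
      scaleR_conv_of_real[where 'a = complex] mult.assoc mult.left_commute[of _ "of_real _"])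

section \<open>Exponential, logarithm and the derivative of powers at exponent zero\<close>

lemma mexp_unitary_diag:
  fixes U :: "complex ^ 'n ^ 'n"
  assumes U: "unitary U"
  shows "mexp (U ** diag h ** adj U) = U ** diag (\<lambda>i. exp (h i)) ** adj U"
proof -
  have pow: "((**) (U ** diag h ** adj U) ^^ k) (mat 1) = U ** diag (\<lambda>i. h i ^ k) ** adj U" for k
    by (induction k) (use U in \<open>simp_all add: diag_conj_mult\<close>)
  have exp: "(\<lambda>k. h i ^ k / fact k) sums exp (h i)" for i
    using exp_converges[of "h i"] by (simp add: divide_inverse mult.commute)
  have "(\<lambda>k. (U ** diag (\<lambda>i. h i ^ k) ** adj U) /\<^sub>R fact k) =
      (\<lambda>k. \<Sum>l\<in>UNIV. (h l ^ k / fact k) *\<^sub>R (\<chi> i j. U $ i $ l * cnj (U $ j $ l)))"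
    by (simp add: diag_conj_sum scaleR_right.sum divide_inverse mult.commute)
  also have "\<dots> sums (\<Sum>l\<in>UNIV. exp (h l) *\<^sub>R (\<chi> i j. U $ i $ l * cnj (U $ j $ l)))"
    by (intro sums_sum bounded_linear.sums[OF bounded_linear_scaleR_left] exp)
  finally show ?thesis
    unfolding mexp_def pow by (simp add: sums_unique[symmetric] diag_conj_sum)
qed

lemma hermitian_mlog: "pos_def A \<Longrightarrow> hermitian (mlog A)"
  by (elim pos_defE) (simp add: mlog_def mfun_unitary_diag hermitian_diag_conj)

lemma pos_def_mexp: "hermitian H \<Longrightarrow> pos_def (mexp H)"
  by (elim hermitian_unitary_diag) (simp add: mexp_unitary_diag pos_def_unitary_diag)

lemma mpow_has_derivative_at_0:
  assumes "pos_def A"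
  shows "((\<lambda>q. mpow A q) has_vector_derivative mlog A) (at 0)"
proof -
  obtain U d where U: "unitary U" "\<And>i. 0 < d i" "A = U ** diag d ** adj U"
    by (rule pos_defE[OF assms]) blast
  have "((\<lambda>q. d l powr q) has_vector_derivative ln (d l)) (at 0)" for l
    using U(2)[of l] unfolding has_real_derivative_iff_has_vector_derivative[symmetric]
    by (auto intro!: derivative_eq_intros simp: less_imp_neq[symmetric])
  then show ?thesis
    unfolding U(3) mpow_unitary_diag[OF U(1)] mlog_def mfun_unitary_diag[OF U(1)]
    unfolding diag_conj_sum
    by (intro has_vector_derivative_sum bounded_linear.has_vector_derivative[OF bounded_linear_scaleR_left])
qed

lemma mpow_mexp_has_derivative_at_0:
  assumes "hermitian H"
  shows "((\<lambda>q. mpow (mexp H) q) has_vector_derivative H) (at 0)"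
proof -
  obtain U h where U: "unitary U" "H = U ** diag h ** adj U"
    using hermitian_unitary_diag[OF assms] .
  have "mlog (mexp H) = H"
    using U by (simp add: mlog_def mexp_unitary_diag mfun_unitary_diag)
  then show ?thesis
    using mpow_has_derivative_at_0[OF pos_def_mexp[OF assms]] by simp
qed

lemma bounded_bilinear_matrix_mult: "bounded_bilinear ((**) :: complex ^ 'n ^ 'm \<Rightarrow> complex ^ 'p ^ 'n \<Rightarrow> _)"
  unfolding bilinear_conv_bounded_bilinear[symmetric] bilinear_def
  by (intro conjI allI linearI)
    (simp_all add: vec_eq_iff matrix_matrix_mult_def algebra_simps sum.distrib scaleR_right.sum)

subsection \<open>Principal minors\<close>

text \<open>The Leibniz formula over the permutations of \<open>S\<close> gives the principal minor
  without a type for submatrices.\<close>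

definition sdet :: "'n set \<Rightarrow> complex ^ 'n ^ 'n \<Rightarrow> complex"
  where "sdet S M = (\<Sum>p | p permutes S. of_int (sign p) * (\<Prod>i\<in>S. M $ i $ p i))"

definition minor_of_rows :: "'n set \<Rightarrow> ('n \<Rightarrow> 'n) \<Rightarrow> complex ^ 'n ^ 'n \<Rightarrow> complex"
  where "minor_of_rows S f W = (\<Sum>p | p permutes S. of_int (sign p) * (\<Prod>i\<in>S. W $ f i $ p i))"

text \<open>A subset with \<open>card S\<close> elements is the image of
  \<open>fact (card S)\<close> injective maps on \<open>S\<close>; the division compensates for
  counting its minor once per map.\<close>

definition minor_weight :: "'n set \<Rightarrow> complex ^ 'n ^ 'n \<Rightarrow> ('n \<Rightarrow> 'n) \<Rightarrow> real"
  where "minor_weight S W f = (cmod (minor_of_rows S f W))\<^sup>2 / fact (card S)"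

lemma minor_weight_nonneg: "0 \<le> minor_weight S W f"
  by (simp add: minor_weight_def)

lemma sum_permutes_sign_comp:
  fixes S :: "'n::finite set"
  assumes "q permutes S"
  shows "(\<Sum>p | p permutes S. of_int (sign p) * g (p \<circ> q)) =
    (of_int (sign q) :: complex) * (\<Sum>p | p permutes S. of_int (sign p) * g p)"
proof -
  have "(\<Sum>p | p permutes S. of_int (sign p) * g p) =
      (\<Sum>p | p permutes S. of_int (sign (p \<circ> q)) * g (p \<circ> q))"
    by (rule sum_permutations_compose_right[OF assms])
  also have "\<dots> = (\<Sum>p | p permutes S. of_int (sign q) * (of_int (sign p) * g (p \<circ> q)))"
    using assms
    by (intro sum.cong) (auto simp: sign_compose permutes_imp_permutation[OF finite])
  also have "\<dots> = of_int (sign q) * (\<Sum>p | p permutes S. of_int (sign p) * g (p \<circ> q))"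
    by (simp add: sum_distrib_left)
  finally show ?thesis
    by (simp add: mult.assoc[symmetric] of_int_mult[symmetric] del: of_int_mult)
qed

lemma minor_of_rows_permute:
  fixes W :: "complex ^ 'n ^ 'n"
  assumes q: "q permutes S"
  shows "minor_of_rows S (f \<circ> q) W = of_int (sign q) * minor_of_rows S f W"
proof -
  have "(\<Prod>i\<in>S. W $ (f \<circ> q) i $ p i) = (\<Prod>i\<in>S. W $ f i $ (p \<circ> inv q) i)" for p
    using prod.permute[OF q, of "\<lambda>i. W $ f i $ (p \<circ> inv q) i"] permutes_inverses[OF q]
    by (simp add: o_def)
  then show ?thesis
    unfolding minor_of_rows_def
    using sum_permutes_sign_comp[OF permutes_inv[OF q], of "\<lambda>p. \<Prod>i\<in>S. W $ f i $ p i"] q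
    by (simp add: sign_inverse permutes_imp_permutation[OF finite])
qed

lemma minor_of_rows_not_inj:
  fixes W :: "complex ^ 'n ^ 'n"
  assumes "\<not> inj_on f S"
  shows "minor_of_rows S f W = 0"
proof -
  from assms obtain a b where ab: "a \<in> S" "b \<in> S" "a \<noteq> b" "f a = f b"
    by (auto simp: inj_on_def)
  have "f \<circ> Transposition.transpose a b = f"
    using ab by (auto simp: fun_eq_iff Transposition.transpose_def)
  then have "minor_of_rows S f W = - minor_of_rows S f W"
    using minor_of_rows_permute[OF permutes_swap_id[OF ab(1,2)], of f W] ab(3)
    by (simp add: sign_swap_id)
  then show ?thesis by simp
qed

text \<open>The Cauchy--Binet expansion. Summing over all maps \<open>f\<close> instead of over subsets makes
  every summand a square after averaging over the permutations of \<open>S\<close>.\<close>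

lemma sdet_diag_conj:
  fixes W :: "complex ^ 'n ^ 'n"
  shows "sdet S (adj W ** diag d ** W) =
    of_real (\<Sum>f\<in>S \<rightarrow>\<^sub>E UNIV. minor_weight S W f * (\<Prod>i\<in>S. d (f i)))"
proof -
  let ?F = "S \<rightarrow>\<^sub>E (UNIV :: 'n set)"
  let ?P = "{p. p permutes S}"
  define D where "D f = complex_of_real (\<Prod>i\<in>S. d (f i))" for f
  have finF: "finite ?F" by (intro finite_PiE) auto
  have finP: "finite ?P" by (intro finite_permutations) auto
  have entry: "(adj W ** diag d ** W) $ i $ j = (\<Sum>l\<in>UNIV. of_real (d l) * cnj (W $ l $ i) * W $ l $ j)" for i j
    by (simp add: matrix_matrix_mult_def[of _ W] mult_diag_nth mult.commute)
  have "sdet S (adj W ** diag d ** W) =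
      (\<Sum>p\<in>?P. of_int (sign p) * (\<Sum>f\<in>?F. \<Prod>i\<in>S. of_real (d (f i)) * cnj (W $ f i $ i) * W $ f i $ p i))"
    unfolding sdet_def entry by (subst prod_sum_PiE) auto
  also have "\<dots> = (\<Sum>f\<in>?F. \<Sum>p\<in>?P. of_int (sign p) * (\<Prod>i\<in>S. of_real (d (f i)) * cnj (W $ f i $ i) * W $ f i $ p i))"
    by (simp add: sum_distrib_left sum.swap[of _ ?P])
  also have "\<dots> = (\<Sum>f\<in>?F. D f * (\<Prod>i\<in>S. cnj (W $ f i $ i)) * minor_of_rows S f W)"
    by (simp add: minor_of_rows_def D_def prod.distrib sum_distrib_left algebra_simps)
  finally have expand: "sdet S (adj W ** diag d ** W) =
      (\<Sum>f\<in>?F. D f * (\<Prod>i\<in>S. cnj (W $ f i $ i)) * minor_of_rows S f W)" .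
  \<comment> \<open>In \<open>expand\<close> the conjugated factor is a single product, not yet a
    minor. Precomposing \<open>f\<close> with \<open>inv q\<close> permutes its columns by
    \<open>q\<close> and produces \<open>sign q\<close>, so the sum over all \<open>q\<close>
    completes it to the conjugate of \<open>minor_of_rows S f W\<close>.\<close>
  have perm: "sdet S (adj W ** diag d ** W) =
      (\<Sum>f\<in>?F. D f * (of_int (sign q) * (\<Prod>i\<in>S. cnj (W $ f i $ q i))) * minor_of_rows S f W)"
    if q: "q permutes S" for q
  proof -
    have qi: "inv q permutes S" using q by (rule permutes_inv)
    have "sdet S (adj W ** diag d ** W) =
        (\<Sum>f\<in>?F. D (f \<circ> inv q) * (\<Prod>i\<in>S. cnj (W $ (f \<circ> inv q) i $ i)) * minor_of_rows S (f \<circ> inv q) W)"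
      unfolding expand
    proof (rule sum.reindex_bij_witness[of _ "\<lambda>f. f \<circ> inv q" "\<lambda>f. f \<circ> q"])
      fix f assume "f \<in> ?F"
      then show "f \<circ> inv q \<in> ?F" "f \<circ> q \<in> ?F"
        using q qi by (auto simp: PiE_iff extensional_def permutes_not_in)
      show "(f \<circ> inv q) \<circ> q = f" "(f \<circ> q) \<circ> inv q = f"
        using permutes_inverses[OF q] by (auto simp: fun_eq_iff)
      show "D (f \<circ> q \<circ> inv q) * (\<Prod>i\<in>S. cnj (W $ (f \<circ> q \<circ> inv q) i $ i)) * minor_of_rows S (f \<circ> q \<circ> inv q) W =
          D f * (\<Prod>i\<in>S. cnj (W $ f i $ i)) * minor_of_rows S f W"
        using permutes_inverses[OF q] by (simp add: comp_assoc o_def)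
    qed
    also have "\<dots> = (\<Sum>f\<in>?F. D f * (of_int (sign q) * (\<Prod>i\<in>S. cnj (W $ f i $ q i))) * minor_of_rows S f W)"
    proof (intro sum.cong refl)
      fix f
      have "D (f \<circ> inv q) = D f"
        using prod.permute[OF qi, of "\<lambda>i. d (f i)"] by (simp add: D_def o_def)
      moreover have "(\<Prod>i\<in>S. cnj (W $ (f \<circ> inv q) i $ i)) = (\<Prod>i\<in>S. cnj (W $ f i $ q i))"
        using prod.permute[OF qi, of "\<lambda>i. cnj (W $ f i $ q i)"] permutes_inverses[OF q] by (simp add: o_def)
      moreover have "minor_of_rows S (f \<circ> inv q) W = of_int (sign q) * minor_of_rows S f W"
        using minor_of_rows_permute[OF qi] q by (simp add: sign_inverse permutes_imp_permutation[OF finite])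
      ultimately show "D (f \<circ> inv q) * (\<Prod>i\<in>S. cnj (W $ (f \<circ> inv q) i $ i)) * minor_of_rows S (f \<circ> inv q) W =
          D f * (of_int (sign q) * (\<Prod>i\<in>S. cnj (W $ f i $ q i))) * minor_of_rows S f W"
        by simp
    qed
    finally show ?thesis .
  qed
  have cnj_minor: "cnj (minor_of_rows S f W) = (\<Sum>q\<in>?P. of_int (sign q) * (\<Prod>i\<in>S. cnj (W $ f i $ q i)))" for f
    by (simp add: minor_of_rows_def)
  have "fact (card S) * sdet S (adj W ** diag d ** W) = (\<Sum>q\<in>?P. sdet S (adj W ** diag d ** W))"
    using card_permutations[of S "card S"] by simp
  also have "\<dots> = (\<Sum>q\<in>?P. \<Sum>f\<in>?F. D f * (of_int (sign q) * (\<Prod>i\<in>S. cnj (W $ f i $ q i))) * minor_of_rows S f W)"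
    by (intro sum.cong refl perm) simp
  also have "\<dots> = (\<Sum>f\<in>?F. D f * cnj (minor_of_rows S f W) * minor_of_rows S f W)"
    by (subst sum.swap) (simp add: cnj_minor sum_distrib_left sum_distrib_right mult.assoc)
  also have "\<dots> = (\<Sum>f\<in>?F. D f * of_real ((cmod (minor_of_rows S f W))\<^sup>2))"
    unfolding complex_norm_square by (simp add: mult.assoc mult.commute[of "cnj _"])
  also have "\<dots> = fact (card S) * (\<Sum>f\<in>?F. of_real (minor_weight S W f) * D f)"
    by (simp add: minor_weight_def sum_distrib_left mult.commute)
  finally show ?thesis
    by (simp add: D_def)
qed

definition kform :: "'n set \<Rightarrow> complex ^ 'n ^ 'n \<Rightarrow> complex ^ 'n ^ 'n \<Rightarrow> real"
  where "kform S P V = Re (sdet S (adj V ** P ** V))"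

lemma kform_conj: "kform S (adj X ** P ** X) V = kform S P (X ** V)"
  by (simp add: kform_def adj_mult matrix_mul_assoc)

lemma kform_unitary_diag:
  "kform S (U ** diag d ** adj U) V =
    (\<Sum>f\<in>S \<rightarrow>\<^sub>E UNIV. minor_weight S (adj U ** V) f * (\<Prod>i\<in>S. d (f i)))"
proof -
  have "adj V ** (U ** diag d ** adj U) ** V = adj (adj U ** V) ** diag d ** (adj U ** V)"
    by (simp add: adj_mult matrix_mul_assoc)
  then show ?thesis by (simp add: kform_def sdet_diag_conj del: of_real_sum of_real_mult of_real_prod)
qed

lemma sdet_diag: "sdet S (diag d) = of_real (\<Prod>i\<in>S. d i)"
proof -
  have "sdet S (diag d) = (\<Sum>p | p permutes S. if p = id then of_real (\<Prod>i\<in>S. d i) else 0)"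
    unfolding sdet_def
  proof (intro sum.cong refl)
    fix p assume "p \<in> {p. p permutes S}"
    then have p: "p permutes S" by simp
    show "of_int (sign p) * (\<Prod>i\<in>S. diag d $ i $ p i) = (if p = id then of_real (\<Prod>i\<in>S. d i) else 0)"
    proof (cases "p = id")
      case False
      then obtain i where "p i \<noteq> i" by (auto simp: fun_eq_iff)
      with p have "i \<in> S" by (metis permutes_not_in)
      with \<open>p i \<noteq> i\<close> have "(\<Prod>i\<in>S. diag d $ i $ p i) = 0"
        by (intro prod_zero bexI[of _ i]) (auto simp: diag_def)
      with False show ?thesis by simp
    qed (simp add: diag_def)
  qed
  also have "\<dots> = of_real (\<Prod>i\<in>S. d i)"
    by (subst sum.delta) (auto simp: finite_permutations permutes_id)
  finally show ?thesis .
qed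

lemma sdet_scale: "sdet S (diag d ** M ** diag e) = of_real ((\<Prod>i\<in>S. d i) * (\<Prod>i\<in>S. e i)) * sdet S M"
proof -
  have "(\<Prod>i\<in>S. (diag d ** M ** diag e) $ i $ p i) = of_real ((\<Prod>i\<in>S. d i) * (\<Prod>i\<in>S. e i)) * (\<Prod>i\<in>S. M $ i $ p i)"
    if p: "p permutes S" for p
    using prod.permute[OF p, of "\<lambda>i. complex_of_real (e i)"]
    by (simp add: mult_diag_nth diag_mult_nth prod.distrib o_def)
  then show ?thesis
    by (simp add: sdet_def sum_distrib_left mult.left_commute)
qed

text \<open>After diagonalizing \<open>adj V ** P ** V\<close> the weights belong to a unitary
  matrix and sum to 1, as the choice \<open>d = 1\<close> shows. The form is thus an average of
  eigenvalue products, hence at least the \<open>card S\<close>-th power of the least eigenvalue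
  \<open>m\<close>.\<close>

lemma kform_pos:
  fixes V :: "complex ^ 'n ^ 'n"
  assumes "pos_def P" "invertible V"
  shows "0 < kform S P V"
proof -
  have "pos_def (adj V ** P ** V)" using assms by (rule pos_def_conj)
  then obtain U d where U: "unitary U" "\<And>i. 0 < d i" "adj V ** P ** V = U ** diag d ** adj U"
    by (rule pos_defE) blast
  define m where "m = Min (range d)"
  have m: "0 < m" "\<And>i. m \<le> d i"
    using U(2) by (auto simp: m_def)
  have "(\<Sum>f\<in>S \<rightarrow>\<^sub>E UNIV. minor_weight S (adj U) f) = 1"
    using kform_unitary_diag[of S U "\<lambda>_. 1" "mat 1"] sdet_diag[of S "\<lambda>_. 1"] U(1)
    by (simp add: kform_def)
  then have "m ^ card S = (\<Sum>f\<in>S \<rightarrow>\<^sub>E UNIV. minor_weight S (adj U) f * (\<Prod>i\<in>S. m))"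
    by (simp add: sum_distrib_right[symmetric])
  also have "\<dots> \<le> (\<Sum>f\<in>S \<rightarrow>\<^sub>E UNIV. minor_weight S (adj U) f * (\<Prod>i\<in>S. d (f i)))"
    using m by (intro sum_mono mult_left_mono minor_weight_nonneg prod_mono) (auto intro: less_imp_le)
  also have "\<dots> = kform S P V"
    using kform_unitary_diag[of S U d "mat 1"] U(3) by (simp add: kform_def)
  finally show ?thesis
    using zero_less_power[OF m(1), of "card S"] by linarith
qed

subsection \<open>Comparison of products of eigenvalues\<close>

text \<open>For \<open>c = 1\<close> this is the order of the \<open>k\<close>-th exterior powers, tested on decomposable vectors
  only.\<close>

definition kle :: "nat \<Rightarrow> real \<Rightarrow> complex ^ 'n ^ 'n \<Rightarrow> complex ^ 'n ^ 'n \<Rightarrow> bool"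
  where "kle k c P Q \<longleftrightarrow> (\<forall>S V. card S = k \<longrightarrow> kform S P V \<le> c * kform S Q V)"

lemma kle_conj:
  fixes P Q X :: "complex ^ 'n ^ 'n"
  shows "kle k c P Q \<Longrightarrow> kle k c (adj X ** P ** X) (adj X ** Q ** X)"
  by (simp add: kle_def kform_conj)

lemma kle_mpow_conj:
  "pos_def A \<Longrightarrow> kle k c P Q \<Longrightarrow> kle k c (mpow A r ** P ** mpow A r) (mpow A r ** Q ** mpow A r)"
  using kle_conj[of k c P Q "mpow A r"] by (simp add: adj_mpow)

lemma kle_trans: "kle k c P Q \<Longrightarrow> kle k d Q R \<Longrightarrow> 0 \<le> c \<Longrightarrow> kle k (c * d) P R"
  unfolding kle_def
  by (smt (verit, best) mult.assoc mult_left_mono)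

lemma kform_one:
  "unitary U \<Longrightarrow> kform S (mat 1) V = (\<Sum>f\<in>S \<rightarrow>\<^sub>E UNIV. minor_weight S (adj U ** V) f)"
  using kform_unitary_diag[of S U "\<lambda>_. 1" V] by simp

lemma kle_one_iff:
  fixes U :: "complex ^ 'n ^ 'n"
  assumes U: "unitary U"
  shows "kle k c (U ** diag d ** adj U) (mat 1) \<longleftrightarrow> (\<forall>T. card T = k \<longrightarrow> (\<Prod>i\<in>T. d i) \<le> c)"
proof (intro iffI allI impI)
  fix T :: "'n set"
  assume "kle k c (U ** diag d ** adj U) (mat 1)" "card T = k"
  then have "kform T (U ** diag d ** adj U) U \<le> c * kform T (mat 1) U"
    by (simp add: kle_def)
  moreover have "adj U ** (U ** diag d ** adj U) ** U = diag d"
    using U by (simp add: matrix_mul_assoc)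
  ultimately show "(\<Prod>i\<in>T. d i) \<le> c"
    using sdet_diag[of T d] sdet_diag[of T "\<lambda>_. 1"] U by (simp add: kform_def del: of_real_prod)
next
  assume le: "\<forall>T. card T = k \<longrightarrow> (\<Prod>i\<in>T. d i) \<le> c"
  show "kle k c (U ** diag d ** adj U) (mat 1)"
    unfolding kle_def
  proof (intro allI impI)
    fix S :: "'n set" and V
    assume S: "card S = k"
    have "minor_weight S (adj U ** V) f * (\<Prod>i\<in>S. d (f i)) \<le> minor_weight S (adj U ** V) f * c" for f
    proof (cases "inj_on f S")
      case True
      then have "(\<Prod>i\<in>S. d (f i)) \<le> c"
        using le[rule_format, of "f ` S"] S by (simp add: card_image prod.reindex)
      then show ?thesis by (intro mult_left_mono minor_weight_nonneg)
    qed (simp add: minor_weight_def minor_of_rows_not_inj)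
    then show "kform S (U ** diag d ** adj U) V \<le> c * kform S (mat 1) V"
      unfolding kform_unitary_diag kform_one[OF U] sum_distrib_left
      by (intro sum_mono) (simp add: mult.commute)
  qed
qed

text \<open>Against \<open>mat 1\<close> only the eigenvalues of \<open>P\<close> enter, so every
  exponent \<open>r \<ge> 0\<close> is allowed; \<open>kle_mpow_mono\<close>, which compares powers
  of two noncommuting matrices, is confined to the unit interval.\<close>

lemma kle_mpow:
  assumes "pos_def P" "0 \<le> r" "kle k c P (mat 1)"
  shows "kle k (c powr r) (mpow P r) (mat 1)"
proof -
  obtain U d where U: "unitary U" "\<And>i. 0 < d i" "P = U ** diag d ** adj U"
    by (rule pos_defE[OF assms(1)]) blast
  have "(\<Prod>i\<in>T. d i powr r) \<le> c powr r" if "card T = k" for T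
  proof -
    have "(\<Prod>i\<in>T. d i powr r) = (\<Prod>i\<in>T. d i) powr r"
      using U(2) by (simp add: prod_powr_distrib less_imp_le)
    also have "\<dots> \<le> c powr r"
      using assms that U(2) by (intro powr_mono2) (auto simp: U(3) kle_one_iff[OF U(1)] prod_nonneg less_imp_le)
    finally show ?thesis .
  qed
  then show ?thesis
    by (simp add: U(3) mpow_unitary_diag[OF U(1)] kle_one_iff[OF U(1)])
qed

text \<open>Applying \<open>X\<close> scales the columns of \<open>V\<close> by \<open>e\<close>,
  which multiplies the minor of \<open>adj V ** V\<close> by the squared product; that minor is
  positive and cancels. Since \<open>V\<close> is merely invertible, nonnormal \<open>X\<close> are
  covered.\<close>

lemma kle_eigenvectors:
  fixes X V :: "complex ^ 'n ^ 'n"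
  assumes V: "invertible V" and XV: "X ** V = V ** diag e"
    and le: "kle k c (adj X ** X) (mat 1)" and T: "card T = k"
  shows "(\<Prod>i\<in>T. e i)\<^sup>2 \<le> c"
proof -
  have "adj V ** (adj X ** X) ** V = adj (X ** V) ** (X ** V)"
    by (simp add: adj_mult matrix_mul_assoc)
  also have "\<dots> = diag e ** (adj V ** mat 1 ** V) ** diag e"
    by (simp add: XV adj_mult matrix_mul_assoc)
  finally have "kform T (adj X ** X) V = (\<Prod>i\<in>T. e i)\<^sup>2 * kform T (mat 1) V"
    by (simp add: kform_def sdet_scale power2_eq_square del: of_real_prod of_real_mult)
  then have "(\<Prod>i\<in>T. e i)\<^sup>2 * kform T (mat 1) V \<le> c * kform T (mat 1) V"
    using le T by (simp add: kle_def) (metis)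
  then show ?thesis
    using kform_pos[OF pos_def_one V, of T] by simp
qed

text \<open>The spectral radius is at most the norm, on the level of \<open>k\<close>-fold products.\<close>

lemma kle_similar:
  fixes X R :: "complex ^ 'n ^ 'n"
  assumes P: "pos_def P" and R: "invertible R" and XR: "X ** R = R ** P"
    and le: "kle k (c\<^sup>2) (adj X ** X) (mat 1)" and c: "0 \<le> c"
  shows "kle k c P (mat 1)"
proof -
  obtain U d where U: "unitary U" "\<And>i. 0 < d i" "P = U ** diag d ** adj U"
    by (rule pos_defE[OF P]) blast
  have "X ** (R ** U) = (R ** U) ** diag d"
    using U(1) by (simp add: matrix_mul_assoc XR) (simp add: U(3) matrix_mul_assoc)
  moreover have "invertible (R ** U)"
    using R invertible_unitary[OF U(1)] by (rule invertible_mult)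
  ultimately have "(\<Prod>i\<in>T. d i)\<^sup>2 \<le> c\<^sup>2" if "card T = k" for T
    using kle_eigenvectors[OF _ _ le that] by blast
  then have "(\<Prod>i\<in>T. d i) \<le> c" if "card T = k" for T
    using that c power2_le_imp_le by blast
  then show ?thesis by (simp add: U(3) kle_one_iff[OF U(1)])
qed

text \<open>Submultiplicativity of the operator norm: for \<open>k = 1\<close> the constants
  \<open>c\<close> and \<open>d\<close> bound the squared norms of \<open>X\<close> and
  \<open>Y\<close>.\<close>

lemma kle_adj_mult_mult:
  fixes X Y :: "complex ^ 'n ^ 'n"
  assumes "kle k c (adj X ** X) (mat 1)" "kle k d (adj Y ** Y) (mat 1)" "0 \<le> c"
  shows "kle k (c * d) (adj (X ** Y) ** (X ** Y)) (mat 1)"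
proof -
  have "kle k c (adj Y ** (adj X ** X) ** Y) (adj Y ** Y)"
    using kle_conj[OF assms(1), of Y] by simp
  from kle_trans[OF this assms(2,3)] show ?thesis
    by (simp add: adj_mult matrix_mul_assoc)
qed

text \<open>By polar decomposition, \<open>W = X ** mpow P (- 1/2)\<close> is unitary and conjugates
  \<open>adj X ** X\<close> into \<open>X ** adj X\<close>.\<close>

lemma kle_adj_commute:
  fixes X :: "complex ^ 'n ^ 'n"
  assumes X: "invertible X" and le: "kle k c (adj X ** X) (mat 1)"
  shows "kle k c (X ** adj X) (mat 1)"
proof -
  define P where "P = adj X ** X"
  have P: "pos_def P"
    using pos_def_conj[OF pos_def_one X] by (simp add: P_def)
  define W where "W = X ** mpow P (- 1/2)"
  have "adj W ** W = mpow P (- 1/2) ** P ** mpow P (- 1/2)"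
    by (simp add: W_def P_def adj_mult adj_mpow[OF P, unfolded P_def] matrix_mul_assoc)
  also have "\<dots> = mpow P (- 1/2) ** mpow P 1 ** mpow P (- 1/2)"
    using P by simp
  also have "\<dots> = mat 1"
    by (simp only: mpow_add[OF P]) (simp add: P)
  finally have WW: "adj W ** W = mat 1" .
  then have WW': "W ** adj W = mat 1"
    using matrix_left_right_inverse by blast
  have X_eq: "X = W ** mpow P (1/2)"
    using P by (simp add: W_def matrix_mul_assoc[symmetric] mpow_mult_inverse)
  have "X ** adj X = W ** (mpow P (1/2) ** mpow P (1/2)) ** adj W"
    by (subst (1 2) X_eq) (simp add: adj_mult adj_mpow[OF P] matrix_mul_assoc)
  also have "\<dots> = W ** P ** adj W"
    using P by (simp add: mpow_add)
  finally have "X ** adj X = adj (adj W) ** P ** adj W" by simp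
  then show ?thesis
    using kle_conj[OF le, of "adj W"] WW' by (simp add: P_def)
qed

text \<open>The case \<open>k = 1\<close> is the Loewner--Heinz inequality; the argument is Pedersen's.\<close>

lemma kle_mpow_midpoint:
  fixes A B :: "complex ^ 'n ^ 'n"
  assumes A: "pos_def A" and B: "pos_def B" and c: "0 < c"
    and s: "kle k (c powr s) (mpow A s) (mpow B s)"
    and r: "kle k (c powr r) (mpow A r) (mpow B r)"
  shows "kle k (c powr ((s + r) / 2)) (mpow A ((s + r) / 2)) (mpow B ((s + r) / 2))"
proof -
  \<comment> \<open>The comparison of \<open>mpow A r\<close> with \<open>mpow B r\<close> is a norm
    bound for \<open>X r\<close>; multiplying the bounds for \<open>adj (X s)\<close> and
    \<open>X r\<close> adds the exponents of \<open>A\<close>.\<close>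
  define X where "X = (\<lambda>r. mpow A (r/2) ** mpow B (- r/2))"
  have XX: "kle k (c powr r) (adj (X r) ** X r) (mat 1)"
    if "kle k (c powr r) (mpow A r) (mpow B r)" for r
  proof -
    have "mpow B (- r/2) ** mpow A r ** mpow B (- r/2) = adj (X r) ** X r"
      by (simp add: X_def adj_mult adj_mpow A B matrix_mul_assoc mpow_add_left)
    moreover have "mpow B (- r/2) ** mpow B r ** mpow B (- r/2) = mat 1"
      by (simp add: mpow_add B)
    ultimately show ?thesis
      using kle_mpow_conj[OF B that, of "- r/2"] by simp
  qed
  have invX: "invertible (X r)" for r
    unfolding X_def by (intro invertible_mult invertible_mpow A B)
  define Z where "Z = adj (X s) ** X r"
  have "kle k (c powr s * c powr r) (adj Z ** Z) (mat 1)"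
    unfolding Z_def using kle_adj_commute[OF invX XX[OF s]] XX[OF r]
    by (intro kle_adj_mult_mult) auto
  then have Z: "kle k ((c powr ((s + r) / 2))\<^sup>2) (adj Z ** Z) (mat 1)"
    using c by (simp add: powr_add[symmetric] power2_eq_square)
  \<comment> \<open>\<open>Z\<close> carries the exponents \<open>- s/2\<close> and
    \<open>- r/2\<close> of \<open>B\<close> on its two sides. The similarity by
    \<open>mpow B ((r - s)/4)\<close> balances them to \<open>- (s + r)/4\<close> each, which makes
    the matrix positive definite.\<close>
  define P where "P = mpow B (- (s + r)/4) ** mpow A ((s + r)/2) ** mpow B (- (s + r)/4)"
  have P: "pos_def P"
    unfolding P_def by (intro pos_def_mpow_conj pos_def_mpow A B)
  have e1: "- r/2 + (r - s)/4 = - (s + r)/4" and e2: "(r - s)/4 + - (s + r)/4 = - s/2"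
    and e3: "s/2 + r/2 = (s + r)/2" and e4: "(s + r)/4 + - (s + r)/4 = 0" 
    and e6: "- (s + r)/4 + (s + r)/4 = 0" and e5: "(s + r)/4 + (s + r)/4 = (s + r)/2"
    by (simp_all add: field_simps)
  have "Z ** mpow B ((r - s)/4) = mpow B (- s/2) ** mpow A ((s + r)/2) ** mpow B (- (s + r)/4)"
    by (simp only: Z_def X_def adj_mult adj_mpow A B matrix_mul_assoc mpow_add_left[OF A] mpow_add_left[OF B] e1 e3)
  also have "\<dots> = mpow B ((r - s)/4) ** P"
    by (simp only: P_def matrix_mul_assoc mpow_add[OF B] e2)
  finally have "kle k (c powr ((s + r) / 2)) P (mat 1)"
    using kle_similar[OF P invertible_mpow[OF B] _ Z] by simp
  moreover have "mpow B ((s + r)/4) ** P ** mpow B ((s + r)/4) = mpow A ((s + r)/2)"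
    by (simp only: P_def matrix_mul_assoc mpow_add[OF B] mpow_add_left[OF B] e4 e6 mpow_zero[OF B]
        matrix_mul_lid matrix_mul_rid)
  moreover have "mpow B ((s + r)/4) ** mat 1 ** mpow B ((s + r)/4) = mpow B ((s + r)/2)"
    by (simp only: matrix_mul_rid mpow_add[OF B] e5)
  ultimately show ?thesis
    using kle_mpow_conj[OF B, of k _ P "mat 1" "(s + r)/4"] by metis
qed

text \<open>Let \<open>a\<close> be the last point of \<open>K\<close> up to \<open>x\<close> and
  \<open>b\<close> the first point from \<open>x\<close> on. If they differed, their midpoint would
  lie in \<open>K\<close> and contradict one of the two choices.\<close>

lemma midpoint_closed_interval:
  fixes K :: "real set"
  assumes "closed K" "0 \<in> K" "1 \<in> K" and mid: "\<And>a b. a \<in> K \<Longrightarrow> b \<in> K \<Longrightarrow> (a + b) / 2 \<in> K"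
    and x: "0 \<le> x" "x \<le> 1"
  shows "x \<in> K"
proof -
  have "compact ({0..x} \<inter> K)" "0 \<in> {0..x} \<inter> K"
    using assms by (auto intro!: compact_Int_closed)
  then obtain a where a: "a \<in> K" "a \<le> x" "\<And>y. y \<in> K \<Longrightarrow> 0 \<le> y \<Longrightarrow> y \<le> x \<Longrightarrow> y \<le> a"
    using compact_attains_sup[of "{0..x} \<inter> K"] by fastforce
  have "compact ({x..1} \<inter> K)" "1 \<in> {x..1} \<inter> K"
    using assms by (auto intro!: compact_Int_closed)
  then obtain b where b: "b \<in> K" "x \<le> b" "\<And>y. y \<in> K \<Longrightarrow> x \<le> y \<Longrightarrow> y \<le> 1 \<Longrightarrow> b \<le> y"
    using compact_attains_inf[of "{x..1} \<inter> K"] by fastforce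
  have "0 \<le> a" "b \<le> 1" using a(3)[OF assms(2)] b(3)[OF assms(3)] x by auto
  then have "a = b"
    using mid[OF a(1) b(1)] a(2) b(2) b(3)[of "(a + b) / 2"] a(3)[of "(a + b) / 2"]
    by (cases "(a + b) / 2 \<le> x") simp_all
  then show ?thesis using a b by (metis order_antisym)
qed

lemma continuous_on_kform_mpow:
  assumes "pos_def A"
  shows "continuous_on T (\<lambda>t. kform S (mpow A t) V)"
proof -
  obtain U d where U: "unitary U" "\<And>i. 0 < d i" "A = U ** diag d ** adj U"
    by (rule pos_defE[OF assms]) blast
  have "d i \<noteq> 0" for i using U(2)[of i] by simp
  then show ?thesis
    unfolding U(3) mpow_unitary_diag[OF U(1)] kform_unitary_diag
    by (intro continuous_intros) auto
qed

text \<open>The admissible exponents form a closed set, stable under midpoints and containing 0 and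
  1.\<close>

theorem kle_mpow_mono:
  fixes A B :: "complex ^ 'n ^ 'n"
  assumes A: "pos_def A" and B: "pos_def B" and c: "0 < c"
    and le: "kle k c A B" and t: "0 \<le> t" "t \<le> 1"
  shows "kle k (c powr t) (mpow A t) (mpow B t)"
proof -
  let ?K = "{t. kle k (c powr t) (mpow A t) (mpow B t)}"
  have "closed ?K"
    unfolding kle_def using c
    by (intro closed_Collect_all closed_Collect_imp closed_Collect_le open_Collect_const
        continuous_on_kform_mpow A B continuous_intros) auto
  moreover have "0 \<in> ?K" using A B c by (simp add: kle_def)
  moreover have "1 \<in> ?K" using A B c le by simp
  ultimately have "t \<in> ?K"
    by (rule midpoint_closed_interval) (use kle_mpow_midpoint[OF A B c] t in simp_all)
  then show ?thesis by simp
qed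

text \<open>With \<open>X = mpow A (1/2) ** mpow B (- 1/2)\<close>, the hypothesis is a bound for
  \<open>adj X ** X\<close>, and the conclusion is the same bound for \<open>X ** adj X\<close>, up
  to congruence.\<close>

lemma kle_inverse:
  fixes A B :: "complex ^ 'n ^ 'n"
  assumes A: "pos_def A" and B: "pos_def B" and le: "kle k c A B"
  shows "kle k c (mpow B (- 1)) (mpow A (- 1))"
proof -
  define X where "X = mpow A (1/2) ** mpow B (- 1/2)"
  have "adj X ** X = mpow B (- 1/2) ** A ** mpow B (- 1/2)"
    using A by (simp add: X_def adj_mult adj_mpow A B matrix_mul_assoc mpow_add_left)
  moreover have "mpow B (- 1/2) ** mpow B 1 ** mpow B (- 1/2) = mat 1"
    by (simp only: mpow_add[OF B]) (simp add: B)
  ultimately have "kle k c (adj X ** X) (mat 1)"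
    using kle_mpow_conj[OF B le, of "- 1/2"] B by simp
  then have "kle k c (X ** adj X) (mat 1)"
    by (intro kle_adj_commute) (auto simp: X_def intro!: invertible_mult invertible_mpow A B)
  from kle_mpow_conj[OF A this, of "- 1/2"] show ?thesis
    by (simp add: X_def adj_mult adj_mpow A B matrix_mul_assoc mpow_add_left mpow_add)
qed

subsection \<open>The weighted geometric mean\<close>

lemma pos_def_geo_mean: "pos_def A \<Longrightarrow> pos_def B \<Longrightarrow> pos_def (geo_mean t A B)"
  unfolding geo_mean_def by (intro pos_def_mpow_conj pos_def_mpow)

text \<open>\<open>P = Z ** adj Z\<close> is the inner factor of the mean of \<open>A\<close> and
  \<open>B\<close>, while \<open>Q = adj Z ** Z\<close> is the inverse of the inner factor with the
  roles exchanged. Intertwining by \<open>Z\<close> turns powers of one into powers of the other.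
  The symmetry yields monotonicity in the first argument from that in the second.\<close>

lemma geo_mean_commute:
  fixes A B :: "complex ^ 'n ^ 'n"
  assumes A: "pos_def A" and B: "pos_def B"
  shows "geo_mean t A B = geo_mean (1 - t) B A"
proof -
  define Z where "Z = mpow A (- 1/2) ** mpow B (1/2)"
  have adjZ: "adj Z = mpow B (1/2) ** mpow A (- 1/2)"
    by (simp add: Z_def adj_mult adj_mpow A B)
  have invZ: "invertible Z"
    unfolding Z_def by (intro invertible_mult invertible_mpow A B)
  define P Q where "P = Z ** adj Z" and "Q = adj Z ** Z"
  have P: "pos_def P" and Q: "pos_def Q"
    using pos_def_conj[OF pos_def_one invZ] pos_def_conj[OF pos_def_one invertible_adj[OF invZ]]
    by (simp_all add: P_def Q_def)
  have PZ: "mpow P r ** Z = Z ** mpow Q r" for r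
    unfolding mpow_def using P Q
    by (intro mfun_intertwine pos_def_hermitian) (auto simp: P_def Q_def matrix_mul_assoc)
  have P_eq: "P = mpow A (- 1/2) ** B ** mpow A (- 1/2)"
    unfolding P_def adjZ unfolding Z_def by (simp add: matrix_mul_assoc mpow_add_left B)
  have AZ: "mpow A (1/2) ** Z = mpow B (1/2)" and ZA: "adj Z ** mpow A (1/2) = mpow B (1/2)"
    by (simp_all add: adjZ) (simp_all add: Z_def matrix_mul_assoc mpow_add mpow_add_left A)
  have "mpow B (- 1/2) ** A ** mpow B (- 1/2) ** Q = mpow B (- 1/2) ** mpow A 1 ** mpow B (- 1/2) ** Q"
    using A by simp
  also have "\<dots> = mat 1"
    unfolding Q_def adjZ unfolding Z_def
    by (simp add: matrix_mul_assoc mpow_add_left mpow_add A B del: mpow_one)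
  finally have "mpow B (- 1/2) ** A ** mpow B (- 1/2) ** Q ** mpow Q (- 1) = mpow Q (- 1)"
    by simp
  moreover have "X ** Q ** mpow Q (- 1) = X" for X :: "complex ^ 'n ^ 'n"
    using mpow_add_left[OF Q, of X 1 "- 1"] Q by simp
  ultimately have Q_inv: "mpow B (- 1/2) ** A ** mpow B (- 1/2) = mpow Q (- 1)"
    by simp
  have "geo_mean (1 - t) B A = mpow B (1/2) ** mpow Q (t - 1) ** mpow B (1/2)"
    unfolding geo_mean_def Q_inv by (simp add: mpow_mpow Q)
  also have "\<dots> = mpow A (1/2) ** (Z ** mpow Q (t - 1)) ** adj Z ** mpow A (1/2)"
    by (subst (1) AZ[symmetric], subst ZA[symmetric]) (simp add: matrix_mul_assoc)
  also have "\<dots> = mpow A (1/2) ** (mpow P (t - 1) ** mpow P 1) ** mpow A (1/2)"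
    using P by (simp add: PZ[symmetric] P_def[symmetric] matrix_mul_assoc[symmetric])
  also have "\<dots> = geo_mean t A B"
    by (simp only: mpow_add[OF P]) (simp add: geo_mean_def P_eq)
  finally show ?thesis by simp
qed

section \<open>Monotonicity of the geometric mean and the squaring inequalities\<close>

lemma kle_geo_mean_right:
  fixes A B B' :: "complex ^ 'n ^ 'n"
  assumes A: "pos_def A" and B: "pos_def B" and B': "pos_def B'" and c: "0 < c"
    and le: "kle k c B B'" and t: "0 \<le> t" "t \<le> 1"
  shows "kle k (c powr t) (geo_mean t A B) (geo_mean t A B')"
  unfolding geo_mean_def
  by (intro kle_mpow_conj A kle_mpow_mono pos_def_mpow_conj B B' c le t)

text \<open>Replacing one argument at a time costs \<open>c powr t\<close> and
  \<open>c powr (1 - t)\<close>, whose product is \<open>c\<close>.\<close>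

lemma kle_geo_mean_mono:
  fixes A B A' B' :: "complex ^ 'n ^ 'n"
  assumes "pos_def A" "pos_def B" "pos_def A'" "pos_def B'" and c: "0 < c"
    and le: "kle k c A A'" "kle k c B B'" and t: "0 \<le> t" "t \<le> 1"
  shows "kle k c (geo_mean t A B) (geo_mean t A' B')"
proof -
  have "kle k (c powr t) (geo_mean t A B) (geo_mean t A B')"
    using assms by (intro kle_geo_mean_right) auto
  moreover have "kle k (c powr (1 - t)) (geo_mean t A B') (geo_mean t A' B')"
    using assms by (simp add: geo_mean_commute[of _ B' t] kle_geo_mean_right)
  ultimately have "kle k (c powr t * c powr (1 - t)) (geo_mean t A B) (geo_mean t A' B')"
    by (rule kle_trans) simp
  then show ?thesis using c by (simp add: powr_add[symmetric])
qed

text \<open>The Ando--Hiai inequality for the exponent 2. With \<open>C = A^(-1/2) B A^(-1/2)\<close> the hypothesis says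
  \<open>A \<le> C^(-t)\<close>, and the mean of the squares is congruent to the mean of \<open>A\<close> and \<open>C A C \<le> C^(2-t)\<close>.\<close>

lemma kle_geo_mean_square:
  fixes A B :: "complex ^ 'n ^ 'n"
  assumes A: "pos_def A" and B: "pos_def B" and c: "0 < c" and t: "0 \<le> t" "t \<le> 1"
    and le: "kle k c (geo_mean t A B) (mat 1)"
  shows "kle k (c\<^sup>2) (geo_mean t (mpow A 2) (mpow B 2)) (mat 1)"
proof -
  define C where "C = mpow A (- 1/2) ** B ** mpow A (- 1/2)"
  have C: "pos_def C"
    unfolding C_def using A B by (rule pos_def_mpow_conj)
  have mean: "geo_mean t A B = mpow A (1/2) ** mpow C t ** mpow A (1/2)"
    by (simp add: geo_mean_def C_def)
  have "mpow A (- 1/2) ** geo_mean t A B ** mpow A (- 1/2) = mpow C t"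
    by (simp add: mean matrix_mul_assoc mpow_add A mpow_add_left)
  moreover have "mpow A (- 1/2) ** mat 1 ** mpow A (- 1/2) = mpow A (- 1)"
    by (simp add: mpow_add A)
  ultimately have "kle k c (mpow C t) (mpow A (- 1))"
    using kle_mpow_conj[OF A le, of "- 1/2"] by simp
  then have "kle k c (mpow (mpow A (- 1)) (- 1)) (mpow (mpow C t) (- 1))"
    by (intro kle_inverse pos_def_mpow A C)
  then have AC: "kle k c A (mpow C (- t))"
    by (simp add: mpow_mpow A C)
  have "mpow C 1 ** mpow C (- t) ** mpow C 1 = mpow C (2 - t)"
    by (simp only: mpow_add[OF C]) simp
  then have CAC: "kle k c (C ** A ** C) (mpow C (2 - t))"
    using kle_mpow_conj[OF C AC, of 1] C by simp
  have pCAC: "pos_def (C ** A ** C)"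
    using pos_def_mpow_conj[OF C A, of 1] C by simp
  \<comment> \<open>The bounding matrices commute, so their mean is the power of \<open>C\<close>
    with exponent \<open>(1 - t) * (- t) + t * (2 - t) = t\<close>, exactly the inner factor of
    \<open>geo_mean t A B\<close>.\<close>
  have "mpow (mpow C (- t)) (- 1/2) ** mpow C (2 - t) ** mpow (mpow C (- t)) (- 1/2) = mpow C 2"
    by (simp add: mpow_mpow C mpow_add)
  then have CC: "geo_mean t (mpow C (- t)) (mpow C (2 - t)) = mpow C t"
    by (simp add: geo_mean_def mpow_mpow C mpow_add)
  have "kle k c (geo_mean t A (C ** A ** C)) (mpow C t)"
    using kle_geo_mean_mono[OF A pCAC _ _ c AC CAC t] by (simp add: pos_def_mpow C CC)
  from kle_mpow_conj[OF A this, of "1/2"]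
  have "kle k c (mpow A (1/2) ** geo_mean t A (C ** A ** C) ** mpow A (1/2)) (geo_mean t A B)"
    by (simp add: mean)
  moreover have "mpow A (1/2) ** geo_mean t A (C ** A ** C) ** mpow A (1/2)
      = geo_mean t (mpow A 2) (mpow B 2)"
  proof -
    \<comment> \<open>Here \<open>C ** A ** C\<close> equals
      \<open>mpow A (- 1/2) ** mpow B 2 ** mpow A (- 1/2)\<close>, so both means have the inner
      factor \<open>mpow A (- 1) ** mpow B 2 ** mpow A (- 1)\<close>.\<close>
    have "C ** A ** C = C ** mpow A 1 ** C"
      using A by simp
    also have "\<dots> = mpow A (- 1/2) ** mpow B 1 ** mpow B 1 ** mpow A (- 1/2)"
      by (simp only: C_def matrix_mul_assoc mpow_add_left[OF A]) (simp add: A B matrix_mul_assoc[symmetric])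
    finally have "mpow A (- 1/2) ** (C ** A ** C) ** mpow A (- 1/2)
        = mpow A (- 1) ** mpow B 2 ** mpow A (- 1)"
      by (simp only: matrix_mul_assoc mpow_add[OF A] mpow_add_left[OF B] mpow_add_left[OF A]) simp
    moreover have "mpow A (1/2) ** mpow A (1/2) = A"
      using A by (simp add: mpow_add)
    then have "X ** mpow A (1/2) ** mpow A (1/2) = X ** A" for X :: "complex ^ 'n ^ 'n"
      by (simp add: matrix_mul_assoc[symmetric])
    ultimately show ?thesis
      using A by (simp add: geo_mean_def mpow_mpow matrix_mul_assoc \<open>mpow A (1/2) ** mpow A (1/2) = A\<close>)
  qed
  ultimately have "kle k c (geo_mean t (mpow A 2) (mpow B 2)) (geo_mean t A B)"
    by simp
  from kle_trans[OF this le] c show ?thesis by (simp add: power2_eq_square)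
qed

lemma kle_geo_mean_iterate:
  fixes A B :: "complex ^ 'n ^ 'n"
  assumes A: "pos_def A" and B: "pos_def B" and t: "0 \<le> t" "t \<le> 1" and c: "0 < c"
    and le: "kle k c (geo_mean t (mpow A (1 / 2 ^ m)) (mpow B (1 / 2 ^ m))) (mat 1)"
  shows "kle k (c ^ 2 ^ m) (geo_mean t A B) (mat 1)"
  using c le
proof (induction m arbitrary: c)
  case 0
  then show ?case by (simp add: A B)
next
  case (Suc m)
  have "kle k (c\<^sup>2) (geo_mean t (mpow A (1 / 2 ^ m)) (mpow B (1 / 2 ^ m))) (mat 1)"
    using kle_geo_mean_square[OF pos_def_mpow[OF A] pos_def_mpow[OF B] Suc.prems(1) t Suc.prems(2)]
    by (simp add: mpow_mpow A B)
  from Suc.IH[OF _ this] Suc.prems(1) show ?case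
    by (simp add: power_mult)
qed

text \<open>The Araki--Lieb--Thirring inequality for the exponent 2.\<close>

lemma kle_sandwich_sqrt:
  fixes X Y :: "complex ^ 'n ^ 'n"
  assumes X: "pos_def X" and Y: "pos_def Y" and c: "0 < c"
    and le: "kle k c (mpow Y (1/2) ** X ** mpow Y (1/2)) (mat 1)"
  shows "kle k (sqrt c) (mpow Y (1/4) ** mpow X (1/2) ** mpow Y (1/4)) (mat 1)"
proof (rule kle_similar)
  \<comment> \<open>\<open>adj ?Z ** ?Z\<close> is the sandwich in the hypothesis, and
    \<open>?Z\<close> itself is similar to the sandwich in the conclusion.\<close>
  let ?Z = "mpow X (1/2) ** mpow Y (1/2)"
  show "pos_def (mpow Y (1/4) ** mpow X (1/2) ** mpow Y (1/4))"
    by (intro pos_def_mpow_conj pos_def_mpow X Y)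
  show "invertible (mpow Y (- 1/4))" by (rule invertible_mpow[OF Y])
  show "?Z ** mpow Y (- 1/4) = mpow Y (- 1/4) ** (mpow Y (1/4) ** mpow X (1/2) ** mpow Y (1/4))"
    by (simp add: matrix_mul_assoc mpow_add mpow_add_left X Y)
  have "adj ?Z ** ?Z = mpow Y (1/2) ** mpow X 1 ** mpow Y (1/2)"
    by (simp add: adj_mult adj_mpow X Y matrix_mul_assoc mpow_add_left del: mpow_one)
  with le c show "kle k ((sqrt c)\<^sup>2) (adj ?Z ** ?Z) (mat 1)"
    by (simp add: X)
qed (use c in simp)

lemma kle_sandwich_iterate:
  fixes A B :: "complex ^ 'n ^ 'n"
  assumes A: "pos_def A" and B: "pos_def B" and c: "0 < c"
    and le: "kle k c (mpow B (b / 2) ** mpow A a ** mpow B (b / 2)) (mat 1)"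
  shows "kle k (c powr (1 / 2 ^ m))
    (mpow B (b / 2 * (1 / 2 ^ m)) ** mpow A (a * (1 / 2 ^ m)) ** mpow B (b / 2 * (1 / 2 ^ m))) (mat 1)"
proof (induction m)
  case 0
  then show ?case using le c by simp
next
  case (Suc m)
  have half: "mpow (mpow B (b / 2 ^ m)) (1/2) = mpow B (b / 2 * (1 / 2 ^ m))"
    "mpow (mpow B (b / 2 ^ m)) (1/4) = mpow B (b / 2 * (1 / 2 ^ Suc m))"
    "mpow (mpow A (a * (1 / 2 ^ m))) (1/2) = mpow A (a * (1 / 2 ^ Suc m))"
    by (simp_all add: mpow_mpow A B mult.commute)
  have "sqrt (c powr (1 / 2 ^ m)) = c powr (1 / 2 ^ Suc m)"
    by (simp add: powr_half_sqrt[symmetric] powr_powr mult.commute)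
  with kle_sandwich_sqrt[OF pos_def_mpow[OF A] pos_def_mpow[OF B] _ Suc[folded half(1)]] c
  show ?case by (simp only: half) simp
qed

subsection \<open>Comparison with the Loewner order\<close>

text \<open>The congruence by \<open>Y\<close> takes \<open>Q\<close> to the identity and
  \<open>P\<close> to \<open>diag d\<close>; the hypothesis at the images of the unit coordinate
  vectors gives \<open>d i \<le> 1\<close>, hence all products are at most 1.\<close>

lemma kle_if_quadratic_form_le:
  fixes P Q :: "complex ^ 'n ^ 'n"
  assumes P: "pos_def P" and Q: "pos_def Q" and le: "\<And>x. inner x (P *v x) \<le> inner x (Q *v x)"
  shows "kle k 1 P Q"
proof -
  define R where "R = mpow Q (- 1/2) ** P ** mpow Q (- 1/2)"
  have "pos_def R" unfolding R_def by (rule pos_def_mpow_conj[OF Q P])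
  then obtain U d where U: "unitary U" "\<And>i. 0 < d i" "R = U ** diag d ** adj U"
    by (rule pos_defE) blast
  define Y where "Y = mpow Q (- 1/2) ** U"
  have YP: "adj Y ** P ** Y = diag d"
  proof -
    have "adj Y ** P ** Y = adj U ** R ** U"
      by (simp add: Y_def R_def adj_mult adj_mpow Q matrix_mul_assoc)
    also have "\<dots> = diag d"
      using U(1) by (simp add: U(3) matrix_mul_assoc)
    finally show ?thesis .
  qed
  have YQ: "adj Y ** Q ** Y = mat 1"
  proof -
    have "adj Y ** Q ** Y = adj U ** (mpow Q (- 1/2) ** mpow Q 1 ** mpow Q (- 1/2)) ** U"
      using Q by (simp add: Y_def adj_mult adj_mpow Q matrix_mul_assoc)
    also have "\<dots> = mat 1"
      by (simp only: mpow_add[OF Q]) (simp add: Q U(1))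
    finally show ?thesis .
  qed
  have d: "d i \<le> 1" for i
  proof -
    have "d i = (\<Sum>j\<in>UNIV. if j = i then d j else 0)" by simp
    also have "\<dots> = inner (axis i 1) (diag d *v axis i 1)"
      unfolding inner_diag by (rule sum.cong) (auto simp: axis_def)
    also have "\<dots> \<le> inner (axis i 1 :: complex ^ 'n) (mat 1 *v axis i 1)"
      unfolding YP[symmetric] YQ[symmetric] inner_conj by (rule le)
    also have "\<dots> = 1" by (simp add: inner_axis_axis)
    finally show ?thesis .
  qed
  have "kle k 1 R (mat 1)"
    unfolding U(3) kle_one_iff[OF U(1)] using U(2) d by (simp add: prod_le_1 less_imp_le)
  from kle_mpow_conj[OF Q this, of "1/2"] show ?thesis
    by (simp add: R_def matrix_mul_assoc mpow_add mpow_add_left Q)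
qed

lemma kle_scaleR_left:
  assumes "0 \<le> r"
  shows "kle k (r ^ k) (r *\<^sub>R P) P"
proof -
  have "kform S (r *\<^sub>R P) V = r ^ card S * kform S P V" for S V
  proof -
    have "adj V ** (r *\<^sub>R P) ** V = diag (\<lambda>_. r) ** (adj V ** P ** V) ** diag (\<lambda>_. 1)"
      by (simp add: vec_eq_iff diag_mult_nth)
        (simp add: matrix_matrix_mult_def sum_distrib_left algebra_simps
          scaleR_conv_of_real[where 'a = complex])
    then show ?thesis
      by (simp add: kform_def sdet_scale del: diag_one of_real_power)
  qed
  then show ?thesis by (simp add: kle_def)
qed

text \<open>Absorbs the slack left by tangent comparisons, which after amplification is
  \<open>exp (e * k)\<close> with \<open>e\<close> arbitrary.\<close>

lemma kle_limit:
  fixes P Q :: "complex ^ 'n ^ 'n"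
  assumes "\<And>e. 0 < e \<Longrightarrow> kle k (exp (e * real k) * c) P Q"
  shows "kle k c P Q"
  unfolding kle_def
proof (intro allI impI)
  fix S :: "'n set" and V assume S: "card S = k"
  have "((\<lambda>e. exp (e * real k) * c * kform S Q V) \<longlongrightarrow> exp (0 * real k) * c * kform S Q V) (at_right 0)"
    by (intro tendsto_intros)
  then have "kform S P V \<le> exp (0 * real k) * c * kform S Q V"
  proof (rule tendsto_lowerbound)
    show "\<forall>\<^sub>F e in at_right 0. kform S P V \<le> exp (e * real k) * c * kform S Q V"
      using eventually_at_right_less[of 0]
      by eventually_elim (use assms S in \<open>simp add: kle_def\<close>)
  qed simp
  then show "kform S P V \<le> c * kform S Q V" by simp
qed

subsection \<open>Matrices with the same tangent at the identity\<close>

lemma quadratic_form_bound: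
  "\<exists>K>0. \<forall>(M :: complex ^ 'n ^ 'n) x. inner x (M *v x) \<le> K * norm M * (norm x)\<^sup>2"
proof -
  have "bilinear ((*v) :: complex ^ 'n ^ 'n \<Rightarrow> complex ^ 'n \<Rightarrow> _)"
    unfolding bilinear_def
    by (intro conjI allI linearI)
      (simp_all add: matrix_vector_right_distrib matrix_vector_mult_add_rdistrib matrix_vector_scaleR
        scaleR_matrix_vector)
  then obtain K where K: "0 < K" "\<And>(M :: complex ^ 'n ^ 'n) x. norm (M *v x) \<le> norm M * norm x * K"
    using bounded_bilinear.pos_bounded unfolding bilinear_conv_bounded_bilinear by blast
  have "inner x (M *v x) \<le> K * norm M * (norm x)\<^sup>2" for M :: "complex ^ 'n ^ 'n" and x
  proof -
    have "inner x (M *v x) \<le> norm x * norm (M *v x)" by (rule norm_cauchy_schwarz)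
    also have "\<dots> \<le> norm x * (norm M * norm x * K)" by (intro mult_left_mono K) simp
    finally show ?thesis by (simp add: power2_eq_square mult_ac)
  qed
  with K show ?thesis by blast
qed

text \<open>The difference \<open>F q - G q\<close> is \<open>o(q)\<close>, and near the identity
  the form of \<open>G q\<close> is at least half of \<open>(norm x)\<^sup>2\<close>. The constant
  \<open>e / (2 * K)\<close> is chosen so that this half turns the absolute error into the relative
  error \<open>e * q\<close>.\<close>

lemma tangent_quadratic_form_le:
  fixes F G :: "real \<Rightarrow> complex ^ 'n ^ 'n"
  assumes F: "(F has_vector_derivative D) (at 0)" and G: "(G has_vector_derivative D) (at 0)"
    and F0: "F 0 = mat 1" and G0: "G 0 = mat 1" and e: "0 < e"
  shows "\<exists>d>0. \<forall>q. 0 < q \<longrightarrow> q < d \<longrightarrow>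
    (\<forall>x. inner x (F q *v x) \<le> (1 + e * q) * inner x (G q *v x))"
proof -
  obtain K where K: "0 < K" "\<And>(M :: complex ^ 'n ^ 'n) x. inner x (M *v x) \<le> K * norm M * (norm x)\<^sup>2"
    using quadratic_form_bound by blast
  have "((\<lambda>q. F q - G q) has_vector_derivative D - D) (at 0)"
    by (intro has_vector_derivative_diff F G)
  then have "\<forall>r>0. \<exists>d>0. \<forall>q. norm (q - 0) < d \<longrightarrow>
      norm ((F q - G q) - (F 0 - G 0) - (q - 0) *\<^sub>R (D - D)) \<le> r * norm (q - 0)"
    unfolding has_vector_derivative_def has_derivative_at_alt by blast
  then obtain d1 where d1: "0 < d1" "\<And>q. \<bar>q\<bar> < d1 \<Longrightarrow> norm (F q - G q) \<le> e / (2 * K) * \<bar>q\<bar>"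
    using e K(1) by (drule_tac spec[of _ "e / (2 * K)"]) (auto simp: F0 G0)
  have "isCont G 0"
    using has_vector_derivative_continuous[OF G] by simp
  then obtain d2 where d2: "0 < d2" "\<And>q. \<bar>q\<bar> < d2 \<Longrightarrow> norm (G q - mat 1) < 1 / (2 * K)"
    using K(1) unfolding continuous_at_eps_delta G0
    by (drule_tac spec[of _ "1 / (2 * K)"]) (auto simp: dist_norm)
  have "inner x (F q *v x) \<le> (1 + e * q) * inner x (G q *v x)" if q: "0 < q" "q < min d1 d2" for q x
  proof -
    have "inner x ((F q - G q) *v x) \<le> K * norm (F q - G q) * (norm x)\<^sup>2" by (rule K)
    also have "\<dots> \<le> K * (e / (2 * K) * q) * (norm x)\<^sup>2"
      using d1(2)[of q] q K(1) by (intro mult_right_mono mult_left_mono) auto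
    finally have 1: "inner x ((F q - G q) *v x) \<le> e * q / 2 * (norm x)\<^sup>2"
      using K(1) by simp
    have "inner x ((mat 1 - G q) *v x) \<le> K * norm (mat 1 - G q) * (norm x)\<^sup>2" by (rule K)
    also have "\<dots> \<le> K * (1 / (2 * K)) * (norm x)\<^sup>2"
      using d2(2)[of q] q K(1) by (intro mult_right_mono mult_left_mono) (auto simp: norm_minus_commute)
    finally have "inner x ((mat 1 - G q) *v x) \<le> 1 / 2 * (norm x)\<^sup>2"
      using K(1) by simp
    then have "(norm x)\<^sup>2 / 2 \<le> inner x (G q *v x)"
      by (simp add: matrix_vector_mult_diff_rdistrib inner_diff_right power2_norm_eq_inner)
    then have "e * q * ((norm x)\<^sup>2 / 2) \<le> e * q * inner x (G q *v x)"
      using e q by (intro mult_left_mono) auto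
    with 1 show ?thesis
      by (simp add: matrix_vector_mult_diff_rdistrib inner_diff_right algebra_simps)
  qed
  with d1(1) d2(1) show ?thesis
    by (intro exI[of _ "min d1 d2"]) simp
qed

text \<open>Enlarging \<open>1 + e * q\<close> to \<open>exp (e * q)\<close> keeps the error an
  exponential under the \<open>k\<close>-th power coming from the minors and under the later
  amplification.\<close>

lemma kle_tangent:
  fixes F G :: "real \<Rightarrow> complex ^ 'n ^ 'n"
  assumes "(F has_vector_derivative D) (at 0)" and "(G has_vector_derivative D) (at 0)"
    and "F 0 = mat 1" and "G 0 = mat 1" and e: "0 < e"
    and F: "\<And>q. pos_def (F q)" and G: "\<And>q. pos_def (G q)"
  shows "\<exists>d>0. \<forall>q. 0 < q \<longrightarrow> q < d \<longrightarrow> kle k (exp (e * q * real k)) (F q) (G q)"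
proof -
  obtain d where d: "0 < d"
    "\<And>q x. 0 < q \<Longrightarrow> q < d \<Longrightarrow> inner x (F q *v x) \<le> (1 + e * q) * inner x (G q *v x)"
    using tangent_quadratic_form_le[OF assms(1-5)] by blast
  have "kle k (exp (e * q * real k)) (F q) (G q)" if q: "0 < q" "q < d" for q
  proof -
    have "(1 + e * q) * inner x (G q *v x) \<le> exp (e * q) * inner x (G q *v x)" for x
      using G[of q] by (intro mult_right_mono exp_ge_add_one_self) (cases "x = 0"; auto simp: pos_def_iff less_imp_le)
    then have "inner x (F q *v x) \<le> inner x ((exp (e * q) *\<^sub>R G q) *v x)" for x
      using d(2)[OF q, of x] by (simp add: scaleR_matrix_vector) (meson order_trans)
    then have "kle k 1 (F q) (exp (e * q) *\<^sub>R G q)"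
      by (intro kle_if_quadratic_form_le F pos_def_scaleR G) auto
    moreover have "kle k (exp (e * q) ^ k) (exp (e * q) *\<^sub>R G q) (G q)"
      by (rule kle_scaleR_left) simp
    ultimately have "kle k (1 * exp (e * q) ^ k) (F q) (G q)"
      by (rule kle_trans) simp
    then show ?thesis by (simp add: exp_of_nat_mult[symmetric] mult.commute)
  qed
  with d(1) show ?thesis by blast
qed

section \<open>Comparison of the geometric mean and of the sandwich with the log-Euclidean
  mean\<close>

lemma powr_le_weighted_mean: "0 < d \<Longrightarrow> 0 \<le> t \<Longrightarrow> t \<le> 1 \<Longrightarrow> d powr t \<le> 1 - t + t * d" for d t :: real
  using Youngs_inequality_0[where \<alpha> = "1 - t" and \<beta> = t and a = 1 and b = d] by simp

text \<open>One congruence takes \<open>A\<close> to the identity, \<open>B\<close> to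
  \<open>diag d\<close> and the mean to the diagonal of the \<open>d i powr t\<close>; what remains
  is the scalar weighted mean inequality.\<close>

lemma geo_mean_quadratic_form_le:
  fixes A B :: "complex ^ 'n ^ 'n"
  assumes A: "pos_def A" and B: "pos_def B" and t: "0 \<le> t" "t \<le> 1"
  shows "inner x (geo_mean t A B *v x) \<le> inner x (((1 - t) *\<^sub>R A + t *\<^sub>R B) *v x)"
proof -
  define C where "C = mpow A (- 1/2) ** B ** mpow A (- 1/2)"
  have "pos_def C" unfolding C_def using A B by (rule pos_def_mpow_conj)
  then obtain U d where U: "unitary U" "\<And>i. 0 < d i" "C = U ** diag d ** adj U"
    by (rule pos_defE) blast
  define Y where "Y = adj U ** mpow A (1/2)"
  have Y: "adj Y = mpow A (1/2) ** U"
    by (simp add: Y_def adj_mult adj_mpow A)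
  have G: "geo_mean t A B = adj Y ** diag (\<lambda>i. d i powr t) ** Y"
    unfolding geo_mean_def C_def[symmetric] U(3) mpow_unitary_diag[OF U(1)] Y
    unfolding Y_def
    by (simp add: matrix_mul_assoc)
  have "A = mpow A (1/2) ** mpow A (1/2)" using A by (simp add: mpow_add)
  also have "\<dots> = adj Y ** mat 1 ** Y"
    using U(1) unfolding Y unfolding Y_def by (simp add: matrix_mul_assoc)
  finally have A_eq: "A = adj Y ** mat 1 ** Y" .
  have "B = mpow A (1/2) ** C ** mpow A (1/2)"
    by (simp add: C_def matrix_mul_assoc mpow_add mpow_add_left A)
  also have "\<dots> = adj Y ** diag d ** Y"
    unfolding U(3) Y unfolding Y_def by (simp add: matrix_mul_assoc)
  finally have B_eq: "B = adj Y ** diag d ** Y" .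
  let ?y = "Y *v x"
  have "inner x (geo_mean t A B *v x) = (\<Sum>i\<in>UNIV. d i powr t * (cmod (?y $ i))\<^sup>2)"
    unfolding G inner_conj inner_diag ..
  also have "\<dots> \<le> (\<Sum>i\<in>UNIV. (1 - t + t * d i) * (cmod (?y $ i))\<^sup>2)"
    by (intro sum_mono mult_right_mono powr_le_weighted_mean U t) simp
  also have "\<dots> = (1 - t) * inner ?y (diag (\<lambda>_. 1) *v ?y) + t * inner ?y (diag d *v ?y)"
    unfolding inner_diag by (simp add: sum_distrib_left sum.distrib algebra_simps sum_subtractf)
  also have "\<dots> = (1 - t) * inner x (A *v x) + t * inner x (B *v x)"
    by (subst A_eq, subst B_eq) (simp only: inner_conj diag_one)
  finally show ?thesis
    by (simp add: matrix_vector_mult_add_rdistrib scaleR_matrix_vector inner_add_right)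
qed

theorem kle_geo_mean_log_euclidean:
  fixes A B :: "complex ^ 'n ^ 'n"
  assumes A: "pos_def A" and B: "pos_def B" and t: "0 \<le> t" "t \<le> 1" and c: "0 < c"
    and le: "kle k c (mexp ((1 - t) *\<^sub>R mlog A + t *\<^sub>R mlog B)) (mat 1)"
  shows "kle k c (geo_mean t A B) (mat 1)"
proof (rule kle_limit)
  fix e :: real assume e: "0 < e"
  define H where "H = (1 - t) *\<^sub>R mlog A + t *\<^sub>R mlog B"
  have H: "hermitian H"
    using hermitian_mlog[OF A] hermitian_mlog[OF B] by (simp add: H_def hermitian_def adj_add adj_scaleR)
  define M where "M q = (1 - t) *\<^sub>R mpow A q + t *\<^sub>R mpow B q" for q
  have M: "pos_def (M q)" for q
    unfolding M_def using t by (intro pos_def_convex pos_def_mpow A B)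
  have "(M has_vector_derivative H) (at 0)"
    unfolding M_def H_def
    by (intro derivative_intros has_vector_derivative_add bounded_linear.has_vector_derivative[OF bounded_linear_scaleR_right]
        mpow_has_derivative_at_0 A B)
  then obtain d where d: "0 < d" "\<And>q. 0 < q \<Longrightarrow> q < d \<Longrightarrow> kle k (exp (e * q * real k)) (M q) (mpow (mexp H) q)"
    using kle_tangent[of M H "mpow (mexp H)" e k] mpow_mexp_has_derivative_at_0[OF H] e M
      pos_def_mpow[OF pos_def_mexp[OF H]]
    by (auto simp: M_def A B pos_def_mexp[OF H] scaleR_left_distrib[symmetric])
  obtain m where m: "(1/2) ^ m < d"
    using real_arch_pow_inv[OF d(1), of "1/2"] by auto
  \<comment> \<open>With \<open>q * 2 ^ m = 1\<close>, the \<open>m\<close> squarings return from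
    the exponent \<open>q\<close> to \<open>A\<close> and \<open>B\<close> and turn the constant
    \<open>exp (e * q * k) * c powr q\<close> into \<open>exp (e * k) * c\<close>.\<close>
  define q :: real where "q = 1 / 2 ^ m"
  have q: "0 < q" "q < d" "q * 2 ^ m = 1"
    using m by (simp_all add: q_def power_one_over)
  have "kle k 1 (geo_mean t (mpow A q) (mpow B q)) (M q)"
    unfolding M_def
    by (intro kle_if_quadratic_form_le geo_mean_quadratic_form_le pos_def_geo_mean pos_def_mpow pos_def_convex A B t)
  from kle_trans[OF this d(2)[OF q(1,2)]]
  have "kle k (exp (e * q * real k)) (geo_mean t (mpow A q) (mpow B q)) (mpow (mexp H) q)" by simp
  from kle_trans[OF this kle_mpow[OF pos_def_mexp[OF H], of q k c]] le q(1)
  have "kle k (exp (e * q * k) * c powr q) (geo_mean t (mpow A q) (mpow B q)) (mat 1)"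
    by (simp add: H_def)
  then have "kle k ((exp (e * q * k) * c powr q) ^ 2 ^ m) (geo_mean t A B) (mat 1)"
    unfolding q_def using c by (intro kle_geo_mean_iterate A B t) auto
  moreover have "(exp (e * q * k) * c powr q) ^ 2 ^ m = exp (e * real k) * c"
  proof -
    have "exp (e * q * k) ^ 2 ^ m = exp (e * real k)"
      using q(3) by (simp add: exp_of_nat_mult[symmetric] mult_ac)
    moreover have "(c powr q) ^ 2 ^ m = c"
      using q(3) c by (simp add: powr_power mult.commute)
    ultimately show ?thesis by (simp add: power_mult_distrib)
  qed
  ultimately show "kle k (exp (e * real k) * c) (geo_mean t A B) (mat 1)" by simp
qed

theorem kle_log_euclidean_sandwich:
  fixes A B :: "complex ^ 'n ^ 'n"
  assumes A: "pos_def A" and B: "pos_def B" and p: "0 < p" and c: "0 < c"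
    and le: "kle k c (mpow B (t * p / 2) ** mpow A ((1 - t) * p) ** mpow B (t * p / 2)) (mat 1)"
  shows "kle k (c powr (1 / p)) (mexp ((1 - t) *\<^sub>R mlog A + t *\<^sub>R mlog B)) (mat 1)"
proof (rule kle_limit)
  fix e :: real assume e: "0 < e"
  define H where "H = (1 - t) *\<^sub>R mlog A + t *\<^sub>R mlog B"
  have H: "hermitian H"
    using hermitian_mlog[OF A] hermitian_mlog[OF B] by (simp add: H_def hermitian_def adj_add adj_scaleR)
  note E = pos_def_mexp[OF H]
  \<comment> \<open>A curve through the identity with tangent \<open>H\<close> at 0 whose value at
    \<open>p\<close> is the sandwich in the hypothesis.\<close>
  define G where "G q = mpow B (t / 2 * q) ** mpow A ((1 - t) * q) ** mpow B (t / 2 * q)" for q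
  have G: "pos_def (G q)" for q
    unfolding G_def by (intro pos_def_mpow_conj pos_def_mpow A B)
  have D: "((\<lambda>q. mpow X (s * q)) has_vector_derivative s *\<^sub>R mlog X) (at 0)"
    if "pos_def X" for X :: "complex ^ 'n ^ 'n" and s
  proof -
    have "((\<lambda>q. s * q) has_vector_derivative s) (at 0)"
      unfolding has_real_derivative_iff_has_vector_derivative[symmetric]
      by (auto intro!: derivative_eq_intros)
    from vector_diff_chain_at[OF this, of "mpow X" "mlog X"] show ?thesis
      using mpow_has_derivative_at_0[OF that] by (simp add: o_def)
  qed
  have "(G has_vector_derivative ((mpow B 0 ** mpow A 0) ** ((t / 2) *\<^sub>R mlog B)
      + (mpow B 0 ** ((1 - t) *\<^sub>R mlog A) + ((t / 2) *\<^sub>R mlog B) ** mpow A 0) ** mpow B 0)) (at 0)"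
    unfolding G_def
    using bounded_bilinear.has_vector_derivative[OF bounded_bilinear_matrix_mult
        bounded_bilinear.has_vector_derivative[OF bounded_bilinear_matrix_mult D[OF B, of "t/2"] D[OF A, of "1 - t"]]
        D[OF B, of "t/2"]]
    by simp
  moreover have "(t / 2) *\<^sub>R mlog B + ((1 - t) *\<^sub>R mlog A + (t / 2) *\<^sub>R mlog B) = H"
    by (simp add: H_def scaleR_left_distrib[symmetric] add.left_commute)
  ultimately have "(G has_vector_derivative H) (at 0)"
    by (simp add: A B)
  then obtain d where d: "0 < d" "\<And>q. 0 < q \<Longrightarrow> q < d \<Longrightarrow> kle k (exp (e * q * real k)) (mpow (mexp H) q) (G q)"
    using kle_tangent[of "mpow (mexp H)" H G e k] mpow_mexp_has_derivative_at_0[OF H] e G pos_def_mpow[OF E]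
    by (auto simp: G_def A B E)
  have "0 < d / p" using d(1) p by simp
  then obtain m where m: "(1/2) ^ m < d / p"
    using real_arch_pow_inv[of "d / p" "1/2"] by auto
  \<comment> \<open>Repeated square roots start at exponent \<open>p\<close>, hence reach
    \<open>p / 2 ^ m\<close>; there \<open>mpow (mexp H) q\<close> is bounded through
    \<open>G q\<close>, and the power \<open>1 / q\<close> recovers \<open>mexp H\<close>.\<close>
  define q where "q = p / 2 ^ m"
  have q: "0 < q" "q < d"
    using m p by (simp_all add: q_def power_one_over field_simps)
  have "G q = mpow B (t * p / 2 * (1 / 2 ^ m)) ** mpow A ((1 - t) * p * (1 / 2 ^ m)) ** mpow B (t * p / 2 * (1 / 2 ^ m))"
    by (simp add: G_def q_def)
  with kle_sandwich_iterate[OF A B c le, of m]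
  have "kle k (c powr (1 / 2 ^ m)) (G q) (mat 1)" by simp
  from kle_trans[OF d(2)[OF q] this]
  have "kle k (exp (e * q * k) * c powr (1 / 2 ^ m)) (mpow (mexp H) q) (mat 1)" by simp
  from kle_mpow[OF pos_def_mpow[OF E] _ this, of "1 / q"] q(1)
  have "kle k ((exp (e * q * k) * c powr (1 / 2 ^ m)) powr (1 / q)) (mexp H) (mat 1)"
    by (simp add: mpow_mpow E)
  moreover have "(exp (e * q * k) * c powr (1 / 2 ^ m)) powr (1 / q) = exp (e * real k) * c powr (1 / p)"
    using q(1) p by (simp add: powr_mult powr_powr exp_powr_real) (simp add: q_def)
  ultimately show "kle k (exp (e * real k) * c powr (1 / p)) (mexp ((1 - t) *\<^sub>R mlog A + t *\<^sub>R mlog B)) (mat 1)"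
    by (simp add: H_def)
qed

subsection \<open>The matrix Young inequality\<close>

text \<open>Padding by the identity outside \<open>S\<close> makes a principal minor a full
  determinant while preserving positive definiteness.\<close>

definition block :: "'n set \<Rightarrow> complex ^ 'n ^ 'n \<Rightarrow> complex ^ 'n ^ 'n"
  where "block S P = diag (indicator S) ** P ** diag (indicator S) + diag (indicator (- S))"

lemma block_nth: "block S P $ i $ j = (if i \<in> S \<and> j \<in> S then P $ i $ j else if i = j \<and> i \<notin> S then 1 else 0)"
  by (simp add: block_def mult_diag_nth diag_mult_nth) (simp add: diag_def indicator_def)

lemma sdet_UNIV: "sdet UNIV M = det M"
  by (simp add: sdet_def det_def)

lemma det_block: "det (block S P) = sdet S P"
proof -
  have "det (block S P) = (\<Sum>p | p permutes S. of_int (sign p) * (\<Prod>i\<in>UNIV. block S P $ i $ p i))"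
    unfolding det_def
  proof (rule sum.mono_neutral_right)
    show "\<forall>p\<in>{p. p permutes UNIV} - {p. p permutes S}. of_int (sign p) * (\<Prod>i\<in>UNIV. block S P $ i $ p i) = 0"
    proof
      fix p assume p: "p \<in> {p. p permutes UNIV} - {p. p permutes S}"
      then have "\<exists>i. i \<notin> S \<and> p i \<noteq> i"
        by (auto simp: permutes_def)
      then obtain i where "i \<notin> S" "p i \<noteq> i" by blast
      then have "(\<Prod>i\<in>UNIV. block S P $ i $ p i) = 0"
        by (intro prod_zero bexI[of _ i]) (auto simp: block_nth)
      then show "of_int (sign p) * (\<Prod>i\<in>UNIV. block S P $ i $ p i) = 0" by simp
    qed
  qed (auto simp: finite_permutations intro: permutes_subset)
  also have "\<dots> = sdet S P"
    unfolding sdet_def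
  proof (intro sum.cong refl)
    fix p assume "p \<in> {p. p permutes S}"
    then have p: "p permutes S" by simp
    have "(\<Prod>i\<in>UNIV. block S P $ i $ p i) = (\<Prod>i\<in>S. block S P $ i $ p i)"
      by (rule prod.mono_neutral_right) (use p in \<open>auto simp: block_nth permutes_not_in\<close>)
    also have "\<dots> = (\<Prod>i\<in>S. P $ i $ p i)"
      by (rule prod.cong) (use p in \<open>auto simp: block_nth permutes_in_image\<close>)
    finally show "of_int (sign p) * (\<Prod>i\<in>UNIV. block S P $ i $ p i) = of_int (sign p) * (\<Prod>i\<in>S. P $ i $ p i)"
      by simp
  qed
  finally show ?thesis .
qed

lemma pos_def_block:
  fixes P :: "complex ^ 'n ^ 'n"
  assumes "pos_def P"
  shows "pos_def (block S P)"
  unfolding pos_def_iff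
proof (intro conjI allI impI)
  have "hermitian (adj (diag (indicator S)) ** P ** diag (indicator S))"
    by (intro hermitian_conj pos_def_hermitian assms)
  then show "hermitian (block S P)"
    by (simp add: hermitian_def block_def adj_add)
next
  fix x :: "complex ^ 'n"
  assume "x \<noteq> 0"
  let ?D = "diag (indicator S) :: complex ^ 'n ^ 'n"
  have eq: "inner x (block S P *v x) = inner (?D *v x) (P *v (?D *v x)) + inner x (diag (indicator (- S)) *v x)"
    using inner_conj[of x ?D P] by (simp add: block_def matrix_vector_mult_add_rdistrib inner_add_right)
  have D: "(?D *v x) $ i = (if i \<in> S then x $ i else 0)" for i
    by (simp add: matrix_vector_mult_def diag_def if_distrib[of "\<lambda>z. z * _"] indicator_def cong: if_cong)
  have 1: "0 \<le> inner x (diag (indicator (- S)) *v x)"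
    unfolding inner_diag by (intro sum_nonneg) simp
  have 2: "0 \<le> inner y (P *v y)" for y
    using assms by (cases "y = 0") (auto simp: pos_def_iff less_imp_le)
  show "0 < inner x (block S P *v x)"
  proof (cases "?D *v x = 0")
    case True
    from \<open>x \<noteq> 0\<close> obtain i where i: "x $ i \<noteq> 0" by (auto simp: vec_eq_iff)
    with True D[of i] have "i \<notin> S" by (auto split: if_splits)
    with i have "0 < inner x (diag (indicator (- S)) *v x)"
      unfolding inner_diag by (intro sum_pos2[where i = i]) auto
    with 2 show ?thesis unfolding eq by (intro add_nonneg_pos) auto
  next
    case False
    with assms 1 show ?thesis unfolding eq by (intro add_pos_nonneg) (auto simp: pos_def_iff)
  qed
qed

lemma conj_linear_combination:
  fixes X P Q Y :: "complex ^ 'n ^ 'n"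
  shows "X ** (a *\<^sub>R P + b *\<^sub>R Q) ** Y = a *\<^sub>R (X ** P ** Y) + b *\<^sub>R (X ** Q ** Y)"
  by (simp only: bounded_bilinear.add_left[OF bounded_bilinear_matrix_mult]
      bounded_bilinear.add_right[OF bounded_bilinear_matrix_mult]
      bounded_bilinear.scaleR_left[OF bounded_bilinear_matrix_mult]
      bounded_bilinear.scaleR_right[OF bounded_bilinear_matrix_mult])

text \<open>A congruence makes \<open>P\<close> the identity and \<open>Q\<close> diagonal. The
  factor \<open>r\<close> contributed by its determinant appears once on either side, since its
  exponents \<open>1 - t\<close> and \<open>t\<close> add to 1, and the rest is a product of scalar
  mean inequalities.\<close>

lemma det_weighted_mean:
  fixes P Q :: "complex ^ 'n ^ 'n"
  assumes P: "pos_def P" and Q: "pos_def Q" and t: "0 \<le> t" "t \<le> 1"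
  shows "Re (det P) powr (1 - t) * Re (det Q) powr t \<le> Re (det ((1 - t) *\<^sub>R P + t *\<^sub>R Q))"
proof -
  define C where "C = mpow P (- 1/2) ** Q ** mpow P (- 1/2)"
  have "pos_def C" unfolding C_def using P Q by (rule pos_def_mpow_conj)
  then obtain U d where U: "unitary U" "\<And>i. 0 < d i" "C = U ** diag d ** adj U"
    by (rule pos_defE) blast
  define Y where "Y = adj U ** mpow P (1/2)"
  have Y: "adj Y = mpow P (1/2) ** U"
    by (simp add: Y_def adj_mult adj_mpow P)
  have "P = mpow P (1/2) ** mpow P (1/2)" using P by (simp add: mpow_add)
  also have "\<dots> = adj Y ** diag (\<lambda>_. 1) ** Y"
    using U(1) unfolding Y unfolding Y_def by (simp add: matrix_mul_assoc)
  finally have P_eq: "P = adj Y ** diag (\<lambda>_. 1) ** Y" .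
  have "Q = mpow P (1/2) ** C ** mpow P (1/2)"
    by (simp add: C_def matrix_mul_assoc mpow_add mpow_add_left P)
  also have "\<dots> = adj Y ** diag d ** Y"
    unfolding U(3) Y unfolding Y_def by (simp add: matrix_mul_assoc)
  finally have Q_eq: "Q = adj Y ** diag d ** Y" .
  define r where "r = Re (det (adj Y) * det Y)"
  have det: "Re (det (adj Y ** diag e ** Y)) = r * (\<Prod>i\<in>UNIV. e i)" for e
    using sdet_diag[of UNIV e] by (simp add: r_def det_mul sdet_UNIV algebra_simps del: of_real_prod)
  have "0 < kform UNIV P (mat 1)"
    by (intro kform_pos P invertible_unitary) (simp add: unitary_def)
  then have "0 < Re (det P)" by (simp add: kform_def sdet_UNIV)
  then have r: "0 < r" by (subst (asm) P_eq) (simp only: det, simp)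
  have mean: "(1 - t) *\<^sub>R P + t *\<^sub>R Q = adj Y ** diag (\<lambda>i. 1 - t + t * d i) ** Y"
  proof -
    have "diag (\<lambda>i. 1 - t + t * d i) = (1 - t) *\<^sub>R diag (\<lambda>_. 1) + t *\<^sub>R (diag d :: complex ^ 'n ^ 'n)"
      by (simp add: vec_eq_iff diag_def scaleR_conv_of_real[where 'a = complex] del: diag_one)
    then show ?thesis
      by (subst P_eq, subst Q_eq) (simp only: conj_linear_combination)
  qed
  have "Re (det P) powr (1 - t) * Re (det Q) powr t = r powr (1 - t) * (r * (\<Prod>i\<in>UNIV. d i)) powr t"
    by (subst P_eq, subst Q_eq) (simp only: det, simp)
  also have "\<dots> = r * (\<Prod>i\<in>UNIV. d i powr t)"
    using r by (simp add: powr_mult prod_powr_distrib powr_diff mult.assoc[symmetric] powr_add[symmetric])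
  also have "\<dots> \<le> r * (\<Prod>i\<in>UNIV. 1 - t + t * d i)"
    using r U(2) t by (intro mult_left_mono prod_mono) (auto intro: powr_le_weighted_mean)
  also have "\<dots> = Re (det ((1 - t) *\<^sub>R P + t *\<^sub>R Q))"
    by (simp add: mean det)
  finally show ?thesis .
qed

text \<open>\<open>block S\<close> respects convex combinations, because the padding
  \<open>(1 - t) + t\<close> is again 1; log-concavity of the full determinant thus passes to
  principal minors.\<close>

lemma kform_weighted_mean:
  fixes X Y V :: "complex ^ 'n ^ 'n"
  assumes X: "pos_def X" and Y: "pos_def Y" and V: "invertible V" and t: "0 \<le> t" "t \<le> 1"
  shows "kform S X V powr (1 - t) * kform S Y V powr t \<le> kform S ((1 - t) *\<^sub>R X + t *\<^sub>R Y) V"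
proof -
  let ?P = "adj V ** X ** V" and ?Q = "adj V ** Y ** V"
  have "adj V ** ((1 - t) *\<^sub>R X + t *\<^sub>R Y) ** V = (1 - t) *\<^sub>R ?P + t *\<^sub>R ?Q"
    by (rule conj_linear_combination)
  moreover have "block S ((1 - t) *\<^sub>R ?P + t *\<^sub>R ?Q) = (1 - t) *\<^sub>R block S ?P + t *\<^sub>R block S ?Q"
    by (simp add: vec_eq_iff block_nth scaleR_left_distrib[symmetric])
  ultimately show ?thesis
    using det_weighted_mean[OF pos_def_block[of ?P S] pos_def_block[of ?Q S] t] X Y V
    by (simp add: kform_def det_block[symmetric] pos_def_conj)
qed

text \<open>By the Cauchy--Binet expansion \<open>r \<mapsto> kform S (mpow Y r) V\<close> is a sum of exponentials with
  nonnegative coefficients; this is Hoelder's inequality for that sum.\<close>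

lemma kform_mpow_log_convex:
  fixes Y V :: "complex ^ 'n ^ 'n"
  assumes Y: "pos_def Y" and V: "invertible V" and t: "0 \<le> t" "t \<le> 1"
  shows "kform S (mpow Y ((1 - t) * a + t * b)) V \<le> kform S (mpow Y a) V powr (1 - t) * kform S (mpow Y b) V powr t"
proof -
  obtain U d where U: "unitary U" "\<And>i. 0 < d i" "Y = U ** diag d ** adj U"
    by (rule pos_defE[OF Y]) blast
  define w where "w = minor_weight S (adj U ** V)"
  define D where "D f = (\<Prod>i\<in>S. d (f i))" for f
  have D: "0 < D f" for f using U(2) by (simp add: D_def prod_pos)
  have k: "kform S (mpow Y r) V = (\<Sum>f\<in>S \<rightarrow>\<^sub>E UNIV. w f * D f powr r)" for r
    by (simp add: U(3) mpow_unitary_diag[OF U(1)] kform_unitary_diag w_def D_def prod_powr_distrib)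
  define Fa Fb where "Fa = kform S (mpow Y a) V" and "Fb = kform S (mpow Y b) V"
  have pos: "0 < Fa" "0 < Fb"
    unfolding Fa_def Fb_def using Y V by (simp_all add: kform_pos pos_def_mpow)
  \<comment> \<open>With this normalisation, Young's inequality applied to each term sums to
    \<open>(1 - t) + t = 1\<close>.\<close>
  define c where "c = Fa powr (1 - t) * Fb powr t"
  have c: "0 < c" using pos by (simp add: c_def)
  have "D f powr ((1 - t) * a + t * b) / c \<le> (1 - t) * (D f powr a / Fa) + t * (D f powr b / Fb)" for f
    using Youngs_inequality_0[of "1 - t" t "D f powr a / Fa" "D f powr b / Fb"] t D[of f] pos
    by (simp add: c_def powr_divide powr_powr powr_add mult.commute)
  then have "w f * (D f powr ((1 - t) * a + t * b) / c) \<le> w f * ((1 - t) * (D f powr a / Fa) + t * (D f powr b / Fb))" for f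
    by (intro mult_left_mono) (simp_all add: w_def minor_weight_nonneg)
  then have "(\<Sum>f\<in>S \<rightarrow>\<^sub>E UNIV. w f * (D f powr ((1 - t) * a + t * b) / c))
      \<le> (\<Sum>f\<in>S \<rightarrow>\<^sub>E UNIV. w f * ((1 - t) * (D f powr a / Fa) + t * (D f powr b / Fb)))"
    by (intro sum_mono)
  also have "\<dots> = (1 - t) * (\<Sum>f\<in>S \<rightarrow>\<^sub>E UNIV. w f * D f powr a) / Fa + t * (\<Sum>f\<in>S \<rightarrow>\<^sub>E UNIV. w f * D f powr b) / Fb"
    by (simp only: sum_distrib_left sum_divide_distrib sum.distrib[symmetric]) (simp add: algebra_simps)
  also have "\<dots> = 1"
    using pos unfolding k[symmetric] by (simp add: Fa_def Fb_def)
  finally have "kform S (mpow Y ((1 - t) * a + t * b)) V / c \<le> 1"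
    by (simp add: k sum_divide_distrib)
  then show ?thesis
    using c by (simp add: c_def Fa_def Fb_def)
qed

theorem kle_young:
  fixes X Y :: "complex ^ 'n ^ 'n"
  assumes X: "pos_def X" and Y: "pos_def Y" and t: "0 \<le> t" "t \<le> 1"
    and le: "kle k c ((1 - t) *\<^sub>R X + t *\<^sub>R Y) (mat 1)"
  shows "kle k c (mpow Y (t/2) ** mpow X (1 - t) ** mpow Y (t/2)) (mat 1)"
proof -
  define P where "P = mpow Y (t/2) ** mpow X (1 - t) ** mpow Y (t/2)"
  have "pos_def P" unfolding P_def by (intro pos_def_mpow_conj pos_def_mpow X Y)
  then obtain U d where U: "unitary U" "\<And>i. 0 < d i" "P = U ** diag d ** adj U"
    by (rule pos_defE) blast
  \<comment> \<open>In terms of \<open>V\<close> the equation \<open>P ** U = U ** diag d\<close>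
    reads \<open>mpow Y t ** V = mpow X (t - 1) ** V ** diag d\<close>. This separates
    \<open>X\<close> from \<open>Y\<close>, so that each can be estimated in its own
    eigenbasis.\<close>
  define V where "V = mpow Y (- t/2) ** U"
  have V: "invertible V"
    unfolding V_def by (intro invertible_mult invertible_mpow Y invertible_unitary U)
  have "mpow X (t - 1) ** V ** diag d = mpow X (t - 1) ** mpow Y (- t/2) ** (P ** U)"
    using U(1) by (simp add: V_def U(3) matrix_mul_assoc)
  also have "\<dots> = mpow Y (t/2) ** U"
    by (simp add: P_def matrix_mul_assoc mpow_add mpow_add_left X Y)
  also have "\<dots> = mpow Y t ** V"
    by (simp add: V_def matrix_mul_assoc mpow_add Y)
  finally have eig: "mpow Y t ** V = mpow X (t - 1) ** V ** diag d" ..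
  have "(\<Prod>i\<in>T. d i) \<le> c" if T: "card T = k" for T
  proof -
    define f1 fX fY fm where "f1 = kform T (mat 1) V" and "fX = kform T X V" and "fY = kform T Y V"
      and "fm = kform T (mpow X (t - 1)) V"
    note fdefs = f1_def fX_def fY_def fm_def
    have pos: "0 < f1" "0 < fX" "0 < fY" "0 < fm"
      unfolding fdefs using X Y V by (simp_all add: kform_pos pos_def_one pos_def_mpow)
    define D where "D = (\<Prod>i\<in>T. d i)"
    have D: "0 < D" using U(2) by (simp add: D_def prod_pos)
    have "adj V ** mpow Y t ** V = diag (\<lambda>_. 1) ** (adj V ** mpow X (t - 1) ** V) ** diag d"
      using eig by (simp add: matrix_mul_assoc[symmetric])
    then have "kform T (mpow Y t) V = D * fm"
      by (simp add: kform_def sdet_scale fm_def D_def del: of_real_prod diag_one)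
    moreover have "kform T (mpow Y t) V \<le> f1 powr (1 - t) * fY powr t"
      using kform_mpow_log_convex[OF Y V t, of T 0 1] by (simp add: Y fdefs)
    ultimately have 1: "D * fm \<le> f1 powr (1 - t) * fY powr t" by simp
    \<comment> \<open>Solves \<open>(1 - s) * (t - 1) + s = 0\<close>: log-convexity between the
      exponents \<open>t - 1\<close> and 1 then bounds \<open>f1\<close> at exponent 0, which gives
      the lower bound for \<open>fm\<close> needed to eliminate it.\<close>
    define s where "s = (1 - t) / (2 - t)"
    have s: "0 \<le> s" "s \<le> 1" "(1 - s) * (t - 1) + s * 1 = 0" "(1 - s) * (2 - t) = 1" "s * (2 - t) = 1 - t"
      using t by (simp_all add: s_def field_simps)
    have "f1 \<le> fm powr (1 - s) * fX powr s"
      using kform_mpow_log_convex[OF X V s(1,2), of T "t - 1" 1] unfolding s(3) by (simp add: X fdefs)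
    then have "f1 powr (2 - t) \<le> (fm powr (1 - s) * fX powr s) powr (2 - t)"
      using pos t by (intro powr_mono2) auto
    also have "\<dots> = fm * fX powr (1 - t)"
      using pos by (simp add: powr_mult powr_powr s(4,5))
    finally have "D * f1 powr (2 - t) \<le> D * fm * fX powr (1 - t)"
      using D by simp
    also have "\<dots> \<le> f1 powr (1 - t) * fY powr t * fX powr (1 - t)"
      using 1 by (intro mult_right_mono) auto
    finally have "f1 powr (1 - t) * (D * f1) \<le> f1 powr (1 - t) * (fX powr (1 - t) * fY powr t)"
      using pos powr_add[of f1 "1 - t" 1] by (simp add: mult_ac)
    then have "D * f1 \<le> fX powr (1 - t) * fY powr t"
      using pos by simp
    also have "\<dots> \<le> kform T ((1 - t) *\<^sub>R X + t *\<^sub>R Y) V"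
      unfolding fdefs by (rule kform_weighted_mean[OF X Y V t])
    also have "\<dots> \<le> c * f1"
      using le T by (simp add: kle_def f1_def)
    finally show ?thesis using pos by (simp add: D_def)
  qed
  then show ?thesis
    unfolding P_def[symmetric] U(3) kle_one_iff[OF U(1)] by blast
qed

subsection \<open>Unitarily invariant norms\<close>

lemma exists_decreasing_enumeration:
  fixes w :: "'n::finite \<Rightarrow> real"
  shows "\<exists>e. bij_betw e {..<CARD('n)} UNIV \<and> (\<forall>i j. i \<le> j \<longrightarrow> j < CARD('n) \<longrightarrow> w (e j) \<le> w (e i))"
proof -
  obtain l :: "'n list" where l: "set l = UNIV" "distinct l"
    using finite_distinct_list[of "UNIV :: 'n set"] by auto
  define xs where "xs = sort_key (\<lambda>i. - w i) l"
  have xs: "set xs = UNIV" "distinct xs"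
    using l by (simp_all add: xs_def)
  then have len: "length xs = CARD('n)"
    by (metis distinct_card)
  have "sorted (map (\<lambda>i. - w i) xs)"
    unfolding xs_def by (rule sorted_sort_key)
  then have "w (xs ! j) \<le> w (xs ! i)" if "i \<le> j" "j < CARD('n)" for i j
    using sorted_nth_mono[of "map (\<lambda>i. - w i) xs" i j] that len by simp
  moreover have "bij_betw ((!) xs) {..<CARD('n)} UNIV"
    using xs len by (intro bij_betw_nth) auto
  ultimately show ?thesis by blast
qed

text \<open>The indices of \<open>J\<close> outside the first \<open>k\<close> are matched with the
  equally many missing ones among the first \<open>k\<close>; each exchange moves to an earlier
  index and hence to a larger factor.\<close>

lemma prod_le_prod_initial_segment:
  fixes z :: "nat \<Rightarrow> real"
  assumes J: "J \<subseteq> {..<n}" "card J = k" and pos: "\<And>j. j < n \<Longrightarrow> 0 < z j"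
    and dec: "\<And>i j. i \<le> j \<Longrightarrow> j < n \<Longrightarrow> z j \<le> z i"
  shows "(\<Prod>j\<in>J. z j) \<le> (\<Prod>j<k. z j)"
proof -
  let ?K = "{..<k}"
  have fin: "finite J" using J(1) finite_subset by blast
  have "card (J - ?K) = card (?K - J)"
    using J(2) fin card_Int_Diff[OF fin, of ?K] card_Int_Diff[of ?K J] by (simp add: Int_commute)
  then obtain h where h: "bij_betw h (J - ?K) (?K - J)"
    using fin by (metis finite_Diff finite_lessThan finite_same_card_bij)
  have "(\<Prod>j\<in>J - ?K. z j) \<le> (\<Prod>j\<in>J - ?K. z (h j))"
  proof (intro prod_mono conjI)
    fix j assume j: "j \<in> J - ?K"
    then have "h j < k" using h by (auto simp: bij_betw_def)
    with j J(1) show "z j \<le> z (h j)" by (intro dec) auto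
    show "0 \<le> z j" using j J(1) pos by (auto intro: less_imp_le)
  qed
  also have "\<dots> = (\<Prod>j\<in>?K - J. z j)"
    using h by (rule prod.reindex_bij_betw)
  finally have "(\<Prod>j\<in>J \<inter> ?K. z j) * (\<Prod>j\<in>J - ?K. z j) \<le> (\<Prod>j\<in>J \<inter> ?K. z j) * (\<Prod>j\<in>?K - J. z j)"
    using J(1) by (intro mult_left_mono prod_nonneg) (auto intro!: less_imp_le[OF pos])
  then show ?thesis
    using prod.Int_Diff[OF fin, of z ?K] prod.Int_Diff[of ?K z J] by (simp add: Int_commute)
qed

text \<open>Abel summation: by induction the weighted partial sum is at least its last weight times
  the unweighted partial sum.\<close>

lemma sum_decreasing_weights_nonneg:
  fixes w a :: "nat \<Rightarrow> real"
  assumes w: "\<And>i j. i \<le> j \<Longrightarrow> j < n \<Longrightarrow> w j \<le> w i" "\<And>j. j < n \<Longrightarrow> 0 \<le> w j"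
    and a: "\<And>m. m \<le> n \<Longrightarrow> 0 \<le> (\<Sum>j<m. a j)"
  shows "0 \<le> (\<Sum>j<n. w j * a j)"
proof -
  have "w m * (\<Sum>j<Suc m. a j) \<le> (\<Sum>j<Suc m. w j * a j)" if "m < n" for m
    using that
  proof (induction m)
    case (Suc m)
    have "w (Suc m) * (\<Sum>j<Suc m. a j) \<le> w m * (\<Sum>j<Suc m. a j)"
      using Suc.prems by (intro mult_right_mono w a) auto
    with Suc show ?case by (simp add: algebra_simps)
  qed simp
  note partial = this
  show ?thesis
  proof (cases n)
    case (Suc m)
    have "0 \<le> w m * (\<Sum>j<Suc m. a j)"
      using Suc by (intro mult_nonneg_nonneg w a) auto
    also have "\<dots> \<le> (\<Sum>j<Suc m. w j * a j)"
      using Suc by (intro partial) simp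
    finally show ?thesis unfolding Suc .
  qed simp
qed

text \<open>Sorting by \<open>c i * x i\<close> instead of \<open>x i\<close> makes the rearrangement inequality unnecessary, and
  \<open>y - x \<ge> x * ln (y / x)\<close> passes from logarithms to the values themselves.\<close>

lemma exists_permutation_sum_le:
  fixes c x y :: "'n::finite \<Rightarrow> real"
  assumes x: "\<And>i. 0 < x i" and y: "\<And>i. 0 < y i" and c: "\<And>i. 0 \<le> c i"
    and maj: "\<And>k b. 0 < b \<Longrightarrow> (\<forall>T. card T = k \<longrightarrow> (\<Prod>i\<in>T. y i) \<le> b) \<Longrightarrow> (\<forall>T. card T = k \<longrightarrow> (\<Prod>i\<in>T. x i) \<le> b)"
  shows "\<exists>s. bij s \<and> (\<Sum>i\<in>UNIV. c i * x i) \<le> (\<Sum>i\<in>UNIV. c i * y (s i))"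
proof -
  let ?n = "CARD('n)"
  obtain e where e: "bij_betw e {..<?n} UNIV"
    and e_dec: "\<And>i j. i \<le> j \<Longrightarrow> j < ?n \<Longrightarrow> c (e j) * x (e j) \<le> c (e i) * x (e i)"
    using exists_decreasing_enumeration[of "\<lambda>i. c i * x i"] by blast
  obtain g where g: "bij_betw g {..<?n} UNIV"
    and g_dec: "\<And>i j. i \<le> j \<Longrightarrow> j < ?n \<Longrightarrow> y (g j) \<le> y (g i)"
    using exists_decreasing_enumeration[of y] by blast
  have g_top: "(\<Prod>i\<in>T. y i) \<le> (\<Prod>j<k. y (g j))" if T: "card T = k" for T :: "'n set" and k
  proof -
    define J where "J = {j \<in> {..<?n}. g j \<in> T}"
    have "bij_betw g J T"
      using g unfolding J_def bij_betw_def inj_on_def by (auto simp: image_iff)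
    then have "(\<Prod>i\<in>T. y i) = (\<Prod>j\<in>J. y (g j))" "card J = k"
      using T by (simp_all add: prod.reindex_bij_betw[symmetric] bij_betw_same_card)
    moreover have "J \<subseteq> {..<?n}" by (auto simp: J_def)
    ultimately show ?thesis
      using prod_le_prod_initial_segment[of J ?n k "\<lambda>j. y (g j)"] y g_dec by simp
  qed
  define a where "a j = ln (y (g j)) - ln (x (e j))" for j
  have "0 \<le> (\<Sum>j<m. a j)" if m: "m \<le> ?n" for m
  proof -
    have inj: "inj_on e {..<m}" using e m by (auto simp: bij_betw_def intro: inj_on_subset)
    have "(\<Prod>j<m. x (e j)) = (\<Prod>i\<in>e ` {..<m}. x i)"
      using inj by (simp add: prod.reindex)
    also have "\<dots> \<le> (\<Prod>j<m. y (g j))"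
      using maj[of "\<Prod>j<m. y (g j)" m] g_top inj by (simp add: prod_pos y card_image)
    finally have "ln (\<Prod>j<m. x (e j)) \<le> ln (\<Prod>j<m. y (g j))"
      using x by (intro ln_mono) (auto simp: prod_pos)
    then show ?thesis
      by (simp add: a_def sum_subtractf ln_prod less_imp_neq[OF x, THEN not_sym] less_imp_neq[OF y, THEN not_sym])
  qed
  then have "0 \<le> (\<Sum>j<?n. c (e j) * x (e j) * a j)"
    using e_dec c x by (intro sum_decreasing_weights_nonneg) (auto simp: less_imp_le)
  also have "\<dots> \<le> (\<Sum>j<?n. c (e j) * (y (g j) - x (e j)))"
  proof (intro sum_mono)
    fix j
    have "a j \<le> y (g j) / x (e j) - 1"
      using ln_le_minus_one[of "y (g j) / x (e j)"] x[of "e j"] y[of "g j"] by (simp add: a_def ln_div)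
    then have "x (e j) * a j \<le> x (e j) * (y (g j) / x (e j) - 1)"
      using x[of "e j"] by (intro mult_left_mono) auto
    also have "\<dots> = y (g j) - x (e j)"
      using x[of "e j"] by (simp add: field_simps)
    finally show "c (e j) * x (e j) * a j \<le> c (e j) * (y (g j) - x (e j))"
      using c[of "e j"] by (simp add: mult.assoc mult_left_mono)
  qed
  finally have le: "(\<Sum>j<?n. c (e j) * x (e j)) \<le> (\<Sum>j<?n. c (e j) * y (g j))"
    by (simp add: right_diff_distrib sum_subtractf)
  \<comment> \<open>The index with the \<open>j\<close>-th largest \<open>c i * x i\<close> is
    assigned the \<open>j\<close>-th largest value of \<open>y\<close>.\<close>
  define s where "s = g \<circ> inv_into {..<?n} e"
  have "bij s"
    unfolding s_def using bij_betw_trans[OF bij_betw_inv_into[OF e] g] .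
  moreover have "s (e j) = g j" if "j < ?n" for j
    using e that by (simp add: s_def bij_betw_def)
  then have "(\<Sum>j<?n. c (e j) * y (g j)) = (\<Sum>j<?n. c (e j) * y (s (e j)))" by simp
  then have "(\<Sum>j<?n. c (e j) * y (g j)) = (\<Sum>i\<in>UNIV. c i * y (s i))"
    using sum.reindex_bij_betw[OF e, of "\<lambda>i. c i * y (s i)"] by simp
  ultimately show ?thesis
    using le sum.reindex_bij_betw[OF e, of "\<lambda>i. c i * x i"] by auto
qed

section \<open>Fan dominance for unitarily invariant norms\<close>

lemma norm_signed_permutation:
  fixes N :: "complex ^ 'n ^ 'n \<Rightarrow> real" and y \<epsilon> :: "'n \<Rightarrow> real"
  assumes N: "unitarily_invariant_norm N" and s: "bij s" and \<epsilon>: "\<And>i. \<epsilon> i = 1 \<or> \<epsilon> i = - 1"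
  shows "N (diag (\<lambda>i. \<epsilon> i * y (s i))) = N (diag y)"
proof -
  define P :: "complex ^ 'n ^ 'n" where "P = (\<chi> i j. if j = s i then 1 else 0)"
  have nth: "(P ** M) $ i $ j = M $ s i $ j" for M :: "complex ^ 'n ^ 'n" and i j
    by (simp add: P_def matrix_matrix_mult_def if_distrib[of "\<lambda>z. z * _"] cong: if_cong)
  have "P ** adj P = mat 1"
    unfolding vec_eq_iff nth using bij_is_inj[OF s] by (auto simp: P_def mat_def inj_eq)
  then have P: "unitary P"
    unfolding unitary_def using matrix_left_right_inverse by blast
  have \<epsilon>2: "\<epsilon> i * \<epsilon> i = 1" for i using \<epsilon>[of i] by auto
  have D: "unitary (diag \<epsilon>)"
    by (simp add: unitary_def diag_mult_diag \<epsilon>2)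
  have "P ** diag y ** adj P = diag (\<lambda>i. y (s i))"
    unfolding matrix_mul_assoc[symmetric] vec_eq_iff nth diag_mult_nth
    using bij_is_inj[OF s] by (auto simp: P_def diag_def inj_eq)
  then have "diag (\<lambda>i. \<epsilon> i * y (s i)) = (diag \<epsilon> ** P) ** diag y ** adj P"
    by (simp add: matrix_mul_assoc[symmetric]) (simp add: diag_mult_diag)
  then show ?thesis
    using N unitary_mult[OF D P] unitary_adj[OF P] by (simp add: unitarily_invariant_norm_def)
qed

text \<open>The vector \<open>x\<close> lies in the convex hull of the signed permutations of
  \<open>y\<close>, all of which have the norm of \<open>diag y\<close>, and the norm ball is
  convex. Membership in the hull is shown by separation: no linear functional can be smaller at
  \<open>x\<close> than at all signed permutations.\<close>

theorem norm_diag_mono: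
  fixes N :: "complex ^ 'n ^ 'n \<Rightarrow> real" and x y :: "'n \<Rightarrow> real"
  assumes N: "unitarily_invariant_norm N" and x: "\<And>i. 0 < x i" and y: "\<And>i. 0 < y i"
    and maj: "\<And>k b. 0 < b \<Longrightarrow> (\<forall>T. card T = k \<longrightarrow> (\<Prod>i\<in>T. y i) \<le> b) \<Longrightarrow> (\<forall>T. card T = k \<longrightarrow> (\<Prod>i\<in>T. x i) \<le> b)"
  shows "N (diag x) \<le> N (diag y)"
proof -
  define v :: "('n \<Rightarrow> bool) \<times> ('n \<Rightarrow> 'n) \<Rightarrow> real ^ 'n"
    where "v = (\<lambda>(b, s). \<chi> i. (if b i then 1 else - 1) * y (s i))"
  define G where "G = v ` (UNIV \<times> {s. bij s})"
  define C where "C = {z :: real ^ 'n. N (diag (\<lambda>i. z $ i)) \<le> N (diag y)}"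
  have tri: "N (X + Y) \<le> N X + N Y" for X Y
    using N by (simp add: unitarily_invariant_norm_def is_matrix_norm_def)
  have scale: "N (r *\<^sub>R X) = \<bar>r\<bar> * N X" for r X
  proof -
    have "r *\<^sub>R X = map_matrix (\<lambda>z. of_real r * z) X"
      by (simp add: vec_eq_iff scaleR_conv_of_real[where 'a = complex])
    then show ?thesis
      using N by (simp add: unitarily_invariant_norm_def is_matrix_norm_def)
  qed
  have "convex C"
  proof (rule convexI)
    fix a b and u w :: real
    assume ab: "a \<in> C" "b \<in> C" and uw: "0 \<le> u" "0 \<le> w" "u + w = 1"
    have "diag (\<lambda>i. (u *\<^sub>R a + w *\<^sub>R b) $ i) = u *\<^sub>R diag (\<lambda>i. a $ i) + w *\<^sub>R (diag (\<lambda>i. b $ i) :: complex ^ 'n ^ 'n)"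
      by (simp add: vec_eq_iff diag_def scaleR_conv_of_real[where 'a = complex])
    then have "N (diag (\<lambda>i. (u *\<^sub>R a + w *\<^sub>R b) $ i)) \<le> u * N (diag (\<lambda>i. a $ i)) + w * N (diag (\<lambda>i. b $ i))"
      using tri[of "u *\<^sub>R diag (\<lambda>i. a $ i)" "w *\<^sub>R diag (\<lambda>i. b $ i)"] uw by (simp add: scale)
    also have "\<dots> \<le> u * N (diag y) + w * N (diag y)"
      using ab uw by (intro add_mono mult_left_mono) (auto simp: C_def)
    also have "\<dots> = N (diag y)"
      using uw by (simp add: distrib_right[symmetric])
    finally show "u *\<^sub>R a + w *\<^sub>R b \<in> C"
      unfolding C_def mem_Collect_eq .
  qed
  moreover have "G \<subseteq> C"
  proof
    fix z assume "z \<in> G"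
    then obtain b s where s: "bij s" and z: "z = v (b, s)" by (auto simp: G_def)
    have "diag (\<lambda>i. z $ i) = diag (\<lambda>i. (if b i then 1 else - 1) * y (s i))"
      by (simp only: z v_def case_prod_conv vec_lambda_beta)
    then show "z \<in> C"
      using norm_signed_permutation[OF N s, of "\<lambda>i. if b i then 1 else - 1" y] by (simp add: C_def)
  qed
  ultimately have "convex hull G \<subseteq> C" by (simp add: hull_minimal)
  moreover have "(\<chi> i. x i) \<in> convex hull G"
  proof (rule ccontr)
    assume "(\<chi> i. x i) \<notin> convex hull G"
    moreover have "closed (convex hull G)"
      by (intro compact_imp_closed finite_imp_compact_convex_hull) (simp add: G_def)
    ultimately obtain a b where ab: "inner a (\<chi> i. x i) < b" "\<And>z. z \<in> convex hull G \<Longrightarrow> b < inner a z"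
      using separating_hyperplane_closed_point[OF convex_convex_hull] by blast
    have "\<exists>s. bij s \<and> (\<Sum>i\<in>UNIV. \<bar>a $ i\<bar> * x i) \<le> (\<Sum>i\<in>UNIV. \<bar>a $ i\<bar> * y (s i))"
      by (rule exists_permutation_sum_le[OF x y]) (simp, rule maj)
    then obtain s where s: "bij s" "(\<Sum>i\<in>UNIV. \<bar>a $ i\<bar> * x i) \<le> (\<Sum>i\<in>UNIV. \<bar>a $ i\<bar> * y (s i))"
      by blast
    \<comment> \<open>The signs are opposite to those of \<open>a\<close>, so the functional takes
      the value minus the sum of \<open>\<bar>a $ i\<bar> * y (s i)\<close>, which is at most its
      value at \<open>x\<close>.\<close>
    have "v (\<lambda>i. a $ i < 0, s) \<in> convex hull G"
      using s(1) by (intro hull_inc) (simp add: G_def)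
    then have "b < inner a (v (\<lambda>i. a $ i < 0, s))" by (rule ab(2))
    also have "\<dots> = - (\<Sum>i\<in>UNIV. \<bar>a $ i\<bar> * y (s i))"
      unfolding sum_negf[symmetric] inner_vec_def by (intro sum.cong) (auto simp: v_def)
    also have "\<dots> \<le> - (\<Sum>i\<in>UNIV. \<bar>a $ i\<bar> * x i)" using s(2) by simp
    also have "\<dots> \<le> inner a (\<chi> i. x i)"
      unfolding sum_negf[symmetric] inner_vec_def
    proof (intro sum_mono)
      fix i
      have "- (\<bar>a $ i\<bar> * x i) \<le> a $ i * x i"
        using x[of i] mult_right_mono[of "- \<bar>a $ i\<bar>" "a $ i" "x i"] by simp
      then show "- (\<bar>a $ i\<bar> * x i) \<le> inner (a $ i) ((\<chi> i. x i) $ i)" by simp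
    qed
    finally show False using ab(1) by simp
  qed
  ultimately show ?thesis by (auto simp: C_def)
qed

text \<open>Quantifying over all bounds \<open>c\<close> compares the largest \<open>k\<close>-fold
  eigenvalue products without ordering the eigenvalues.\<close>

corollary norm_le_if_kle:
  fixes N :: "complex ^ 'n ^ 'n \<Rightarrow> real"
  assumes N: "unitarily_invariant_norm N" and X: "pos_def X" and Y: "pos_def Y"
    and maj: "\<And>k c. 0 < c \<Longrightarrow> kle k c Y (mat 1) \<Longrightarrow> kle k c X (mat 1)"
  shows "N X \<le> N Y"
proof -
  obtain U x where U: "unitary U" "\<And>i. 0 < x i" "X = U ** diag x ** adj U"
    by (rule pos_defE[OF X]) blast
  obtain V y where V: "unitary V" "\<And>i. 0 < y i" "Y = V ** diag y ** adj V"
    by (rule pos_defE[OF Y]) blast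
  have "N (diag x) \<le> N (diag y)"
    using maj unfolding U(3) V(3) kle_one_iff[OF U(1)] kle_one_iff[OF V(1)]
    by (intro norm_diag_mono N U(2) V(2)) blast
  then show ?thesis
    using N U(1) V(1) unitary_adj[OF U(1)] unitary_adj[OF V(1)]
    by (simp add: U(3) V(3) unitarily_invariant_norm_def)
qed

theorem mainTheorem4:
  fixes A B :: "complex ^ 'n ^ 'n"
    and t p :: real
    and N :: "complex ^ 'n ^ 'n \<Rightarrow> real"
  assumes "pos_def A" and "pos_def B"
    and "0 \<le> t" and "t \<le> 1" and "p > 0"
    and "unitarily_invariant_norm N"
  shows "N (geo_mean t A B) \<le> N (mexp ((1 - t) *\<^sub>R mlog A + t *\<^sub>R mlog B))
    \<and> N (mexp ((1 - t) *\<^sub>R mlog A + t *\<^sub>R mlog B))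
        \<le> N (mpow (mpow B (t * p / 2) ** mpow A ((1 - t) * p) ** mpow B (t * p / 2)) (1 / p))
    \<and> N (mpow (mpow B (t * p / 2) ** mpow A ((1 - t) * p) ** mpow B (t * p / 2)) (1 / p))
        \<le> N (mpow ((1 - t) *\<^sub>R mpow A p + t *\<^sub>R mpow B p) (1 / p))"
proof (intro conjI)
  note A = assms(1) and B = assms(2) and t = assms(3,4) and p = assms(5) and N = assms(6)
  let ?E = "mexp ((1 - t) *\<^sub>R mlog A + t *\<^sub>R mlog B)"
  let ?S = "mpow B (t * p / 2) ** mpow A ((1 - t) * p) ** mpow B (t * p / 2)"
  let ?M = "(1 - t) *\<^sub>R mpow A p + t *\<^sub>R mpow B p"
  have E: "pos_def ?E"
    using hermitian_mlog[OF A] hermitian_mlog[OF B]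
    by (intro pos_def_mexp) (simp add: hermitian_def adj_add adj_scaleR)
  have S: "pos_def ?S" by (intro pos_def_mpow_conj pos_def_mpow A B)
  have M: "pos_def ?M" by (intro pos_def_convex pos_def_mpow A B t)
  \<comment> \<open>The outer \<open>p\<close>-th root is removed at the price of replacing
    \<open>c\<close> by \<open>c powr p\<close>; \<open>cp\<close> restores the constant.\<close>
  have root: "kle k (c powr p) X (mat 1)" if "pos_def X" "kle k c (mpow X (1 / p)) (mat 1)"
    for X :: "complex ^ 'n ^ 'n" and k c
    using kle_mpow[OF pos_def_mpow[OF that(1)] _ that(2), of p] p that(1) by (simp add: mpow_mpow)
  have cp: "(c powr p) powr (1 / p) = c" if "0 < c" for c
    using that p by (simp add: powr_powr)
  show "N (geo_mean t A B) \<le> N ?E"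
    by (intro norm_le_if_kle N pos_def_geo_mean A B E kle_geo_mean_log_euclidean t)
  show "N ?E \<le> N (mpow ?S (1 / p))"
  proof (intro norm_le_if_kle N E pos_def_mpow S)
    fix k c assume c: "0 < c" "kle k c (mpow ?S (1 / p)) (mat 1)"
    then show "kle k c ?E (mat 1)"
      using kle_log_euclidean_sandwich[OF A B p _ root[OF S c(2)]] by (simp add: cp)
  qed
  show "N (mpow ?S (1 / p)) \<le> N (mpow ?M (1 / p))"
  proof (intro norm_le_if_kle N pos_def_mpow S M)
    fix k c assume c: "0 < c" "kle k c (mpow ?M (1 / p)) (mat 1)"
    have "kle k (c powr p) ?S (mat 1)"
      using kle_young[OF pos_def_mpow[OF A] pos_def_mpow[OF B] t root[OF M c(2)]]
      by (simp add: mpow_mpow A B mult.commute)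
    from kle_mpow[OF S _ this, of "1 / p"] show "kle k c (mpow ?S (1 / p)) (mat 1)"
      using p c(1) by (simp add: cp)
  qed
qed

end
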